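(* Consider the multi-cell Massive MIMO system with MMSE channel estimation at the BSs described in the context, with $M>K$. Suppose all channels are subject to i.i.d. Rayleigh fading, i.e. $\mathbf g_{l'k'}^{l}\sim\mathcal{CN}(\mathbf 0,\beta_{l'k'}^{l}\mathbf I_M)$, and each BS uses zero-forcing (ZF) precoding $\mathbf w_{lk}=\mathbf z_{lk}/\sqrt{\mathbb E\{\|\mathbf z_{lk}\|^2\}}$, where $\mathbf z_{lk}$ is the $k$-th column of $\widehat{\mathbf G}_l(\widehat{\mathbf G}_l^{\rm H}\widehat{\mathbf G}_l)^{-1}$ and $\widehat{\mathbf G}_l=[\hat{\mathbf g}_{l1}^{l},\dots,\hat{\mathbf g}_{lK}^{l}]\in\mathbb C^{M\times K}$. Then the proposed estimator $$\hat\alpha_{lk}^{lk}=\begin{cases}\sqrt{(\xi_{lk}-T_{lk})/\eta_{lk}}, & \xi_{lk}>\Theta_{lk},\\ \mathbb E\{\alpha_{lk}^{lk}\}, & \text{otherwise,}\end{cases}$$ where $T_{lk}=\sum_{k'\ne k}\eta_{lk'}\mathbb E\{|\alpha_{lk}^{lk'}|^2\}+\sum_{l'\ne l}\sum_{k'=1}^K\eta_{l'k'}\mathbb E\{|\alpha_{lk}^{l'k'}|^2\}+\sigma_{\mathrm{DL}}^2$, can be computed with $$\begin{aligned}T_{lk}={}&\bigl(\beta_{lk}^{l}-\gamma_{lk}^{l}\bigr)\sum_{\substack{k'=1\\k'\neq k}}^{K}\rho_{\rm dl}\eta_{lk'}+\sum_{l'\in\mathcal P_l\setminus\{l\}}\sum_{k'=1}^{K}\rho_{\rm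 dl}\eta_{l'k'}\bigl(\beta_{lk}^{l'}-\gamma_{lk}^{l'}\bigr)+\sum_{l'\notin\mathcal P_l}\sum_{k'=1}^{K}\rho_{\rm dl}\eta_{l'k'}\beta_{lk}^{l'}\\&+(M-K)\sum_{l'\in\mathcal P_l\setminus\{l\}}\rho_{\rm dl}\eta_{l'k}\gamma_{lk}^{l'}+\sigma_{\mathrm{DL}}^2 .\end{aligned}$$
   Context: There are $L$ cells, each with an $M$-antenna BS and $K$ single-antenna users. $\mathbf g_{l'k'}^{l}\in\mathbb C^M$ is the channel between BS $l$ and user $k'$ in cell $l'$, with large-scale fading coefficient $\beta_{l'k'}^{l}\ge0$ ($\beta_{lk}^{l}>0$); channels of different (BS, user) pairs are independent. Pilots: the cells are partitioned into groups; $\mathcal P_l$ is the group containing $l$ (cells using the same set of $K$ orthogonal pilots of length $\tau_p$). User $k$ of cell $l$ uses the same pilot as user $k$ of each cell in $\mathcal P_l$, and a pilot orthogonal to those of all other users. Pilot powers are $\hat p_{lk}>0$. After correlating with the pilot of user $k$ in cell $l$, BS $l$ has the observation $$\tilde{\mathbf y}_{lk}=\sum_{l'\in\mathcal P_l}\tau_p\sqrt{\hat p_{l'k}}\,\mathbf g_{l'k}^{l}+\tilde{\mathbf n}_{lk},\qquad \tilde{\mathbf n}_{lk}\sim\mathcal{CN}(\mathbf 0,\tau_p\sigma_{\mathrm{UL}}^2\mathbf I_M),$$ with $\sigma_{\mathrm{UL}}^2>0$ and noises independent of all channels and of each other. The MMSE estimate is $$\hat{\mathbf g}_{lk}^{l}=\frac{\sqrt{\hat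 p_{lk}}\,\beta_{lk}^{l}}{\tau_p\sum_{l'\in\mathcal P_l}\hat p_{l'k}\beta_{l'k}^{l}+\sigma_{\mathrm{UL}}^2}\,\tilde{\mathbf y}_{lk}.$$ For $l'\in\mathcal P_l$ (including $l'=l$), $\gamma_{lk}^{l'}$ is the per-antenna variance of BS $l'$'s MMSE estimate of $\mathbf g_{lk}^{l'}$: $$\gamma_{lk}^{l'}=\frac{\tau_p\hat p_{lk}(\beta_{lk}^{l'})^2}{\tau_p\sum_{l''\in\mathcal P_{l}}\hat p_{l''k}\beta_{l''k}^{l'}+\sigma_{\mathrm{UL}}^2}.$$ Downlink: $\mathbf w_{lk}\in\mathbb C^M$ is the precoding vector of BS $l$ for its user $k$; $\alpha_{lk}^{l'k'}=\sqrt{\rho_{\rm dl}}\,(\mathbf g_{lk}^{l'})^{\rm H}\mathbf w_{l'k'}$ is the effective channel gain; $\rho_{\rm dl}>0$ is the maximum downlink power; $\eta_{lk}\in[0,1]$ are fixed power coefficients; $\sigma_{\mathrm{DL}}^2$ is the downlink noise variance. Expectations are over the channel realizations and pilot noise. $\xi_{lk}$ is the sample average $\frac{1}{\tau_c-\tau_p}\sum_{n}|y_{lk}[n]|^2$ of the power of the signals $y_{lk}[n]$ received by user $k$ in cell $l$ during the data part of a coherence interval of $\tau_c$ symbols, and $\Theta_{lk}\ge T_{lk}$ is a chosen threshold. *)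

theory Defs
  imports "HOL-Probability.Probability"
begin

text \<open>
  The number of cells, users per cell and BS antennas are \<open>CARD('l)\<close>, \<open>CARD('k)\<close> and \<open>CARD('m)\<close>.
  In \<open>channel S b l k\<close> and \<open>fading S b l k\<close> (and everywhere below), \<open>b\<close> is the base station and
  \<open>(l, k)\<close> is user \<open>k\<close> of cell \<open>l\<close>, i.e. these are the symbols with superscript \<open>b\<close> and subscript \<open>lk\<close>. The fields \<open>ul_noise_var\<close> and \<open>dl_noise_var\<close> are variances (sigma squared), and
  \<open>noise S l k\<close> is the noise after correlation with the pilot of user \<open>(l, k)\<close>.
\<close>

record ('w, 'l, 'k, 'm :: finite) mimo =
  pspace :: "'w measure"
  group :: "'l \<Rightarrow> 'l set"
  pilot_len :: nat
  pilot :: "'l \<Rightarrow> 'k \<Rightarrow> nat \<Rightarrow> complex"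
  pilot_power :: "'l \<Rightarrow> 'k \<Rightarrow> real"
  fading :: "'l \<Rightarrow> 'l \<Rightarrow> 'k \<Rightarrow> real"
  channel :: "'l \<Rightarrow> 'l \<Rightarrow> 'k \<Rightarrow> 'w \<Rightarrow> complex ^ 'm"
  noise :: "'l \<Rightarrow> 'k \<Rightarrow> 'w \<Rightarrow> complex ^ 'm"
  ul_noise_var :: real
  dl_noise_var :: real
  max_power :: real
  power_coeff :: "'l \<Rightarrow> 'k \<Rightarrow> real"

text \<open>
  The circularly symmetric complex Gaussian law with mean \<open>0\<close> and covariance \<open>v\<close> times the
  identity: \<open>v\<close> is the variance of each complex coordinate. For \<open>v = 0\<close> it is a point mass.
  Here \<open>lborel\<close> is Lebesgue measure on the underlying real space of dimension \<open>2 * CARD('m)\<close>.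
\<close>

definition complex_gaussian :: "real \<Rightarrow> (complex ^ 'm :: finite) measure" where
  "complex_gaussian v =
     (if v = 0 then return borel 0
      else density lborel (\<lambda>x. ennreal (exp (- (norm x)\<^sup>2 / v) / (pi * v) ^ CARD('m))))"

locale rayleigh_mimo =
  fixes S :: "('w, 'l :: finite, 'k :: finite, 'm :: finite) mimo"
  assumes prob_space_pspace: "prob_space (pspace S)"
    and partition_group: "partition_on UNIV (range (group S))"
    and own_group: "l \<in> group S l"
    and pilot_len_pos: "pilot_len S > 0"
    and pilot_energy: "(\<Sum>t<pilot_len S. (cmod (pilot S l k t))\<^sup>2) = real (pilot_len S)"
    and pilot_reuse: "l' \<in> group S l \<Longrightarrow> pilot S l' k = pilot S l k"
    and pilot_orthogonal: "\<not> (l' \<in> group S l \<and> k' = k) \<Longrightarrow>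
          (\<Sum>t<pilot_len S. pilot S l' k' t * cnj (pilot S l k t)) = 0"
    and pilot_power_pos: "pilot_power S l k > 0"
    and fading_nonneg: "fading S b l k \<ge> 0"
    and fading_own_pos: "fading S l l k > 0"
    and ul_noise_var_pos: "ul_noise_var S > 0"
    and dl_noise_var_nonneg: "dl_noise_var S \<ge> 0"
    and max_power_pos: "max_power S > 0"
    and power_coeff_range: "power_coeff S l k \<in> {0..1}"
    and channel_distr: "distr (pspace S) borel (channel S b l k) = complex_gaussian (fading S b l k)"
    and noise_distr: "distr (pspace S) borel (noise S l k) =
          complex_gaussian (real (pilot_len S) * ul_noise_var S)"
    \<comment> \<open>Mutual independence of all channels and all noises; it includes their measurability.\<close>
    and independent: "prob_space.indep_vars (pspace S) (\<lambda>_. borel)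
          (case_sum (\<lambda>(b, l, k). channel S b l k) (\<lambda>(l, k). noise S l k)) UNIV"

definition observation ::
    "('w, 'l :: finite, 'k :: finite, 'm :: finite) mimo \<Rightarrow> 'l \<Rightarrow> 'k \<Rightarrow> 'w \<Rightarrow> complex ^ 'm" where
  "observation S l k \<omega> =
     (\<Sum>l'\<in>group S l. (real (pilot_len S) * sqrt (pilot_power S l' k)) *\<^sub>R channel S l l' k \<omega>)
     + noise S l k \<omega>"

text \<open>
  The observation is the sum of the pilot signals of all users, correlated with the pilot of
  user \<open>(l, k)\<close>.
\<close>

lemma (in rayleigh_mimo) observation_correlation:
  "observation S l k \<omega> =
     (\<Sum>l'\<in>UNIV. \<Sum>k'\<in>UNIV.
        (complex_of_real (sqrt (pilot_power S l' k')) *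
          (\<Sum>t<pilot_len S. pilot S l' k' t * cnj (pilot S l k t))) *s channel S l l' k' \<omega>)
     + noise S l k \<omega>"
proof -
  let ?c = "\<lambda>l' k'. \<Sum>t<pilot_len S. pilot S l' k' t * cnj (pilot S l k t)"
  let ?f = "\<lambda>l' k'. (complex_of_real (sqrt (pilot_power S l' k')) * ?c l' k') *s channel S l l' k' \<omega>"
  have c: "?c l' k = of_nat (pilot_len S)" if "l' \<in> group S l" for l'
  proof -
    have "?c l' k = complex_of_real (\<Sum>t<pilot_len S. (cmod (pilot S l k t))\<^sup>2)"
      by (simp add: pilot_reuse[OF that] complex_norm_square[symmetric])
    then show ?thesis by (simp add: pilot_energy)
  qed
  have "(\<Sum>k'\<in>UNIV. ?f l' k') = (if l' \<in> group S l then ?f l' k else 0)" for l'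
  proof -
    have "(\<Sum>k'\<in>UNIV. ?f l' k') = (\<Sum>k'\<in>UNIV. if k' = k then ?f l' k else 0)"
      by (rule sum.cong) (auto simp: pilot_orthogonal)
    then show ?thesis by (auto simp: pilot_orthogonal)
  qed
  moreover have "(if l' \<in> group S l then ?f l' k else 0) =
      (if l' \<in> group S l
       then (real (pilot_len S) * sqrt (pilot_power S l' k)) *\<^sub>R channel S l l' k \<omega> else 0)" for l'
    by (simp add: c vec_eq_iff scaleR_conv_of_real[where 'a = complex] mult_ac)
  ultimately show ?thesis
    by (simp add: observation_def sum.If_cases)
qed

definition mmse_estimate ::
    "('w, 'l :: finite, 'k :: finite, 'm :: finite) mimo \<Rightarrow> 'l \<Rightarrow> 'k \<Rightarrow> 'w \<Rightarrow> complex ^ 'm" where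
  "mmse_estimate S l k \<omega> =
     (sqrt (pilot_power S l k) * fading S l l k /
       (real (pilot_len S) * (\<Sum>l'\<in>group S l. pilot_power S l' k * fading S l l' k)
         + ul_noise_var S)) *\<^sub>R observation S l k \<omega>"

text \<open>Only meaningful for \<open>b \<in> group S l\<close>.\<close>

definition gamma ::
    "('w, 'l :: finite, 'k :: finite, 'm :: finite) mimo \<Rightarrow> 'l \<Rightarrow> 'l \<Rightarrow> 'k \<Rightarrow> real" where
  "gamma S b l k =
     real (pilot_len S) * pilot_power S l k * (fading S b l k)\<^sup>2 /
       (real (pilot_len S) * (\<Sum>l''\<in>group S l. pilot_power S l'' k * fading S b l'' k)
         + ul_noise_var S)"

definition conj_transpose :: "complex ^ 'n ^ 'm \<Rightarrow> complex ^ 'm ^ 'n" where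
  "conj_transpose A = (\<chi> i j. cnj (A $ j $ i))"

definition estimate_matrix ::
    "('w, 'l :: finite, 'k :: finite, 'm :: finite) mimo \<Rightarrow> 'l \<Rightarrow> 'w \<Rightarrow> complex ^ 'k ^ 'm" where
  "estimate_matrix S l \<omega> = (\<chi> i k. mmse_estimate S l k \<omega> $ i)"

definition zf_direction ::
    "('w, 'l :: finite, 'k :: finite, 'm :: finite) mimo \<Rightarrow> 'l \<Rightarrow> 'k \<Rightarrow> 'w \<Rightarrow> complex ^ 'm" where
  "zf_direction S l k \<omega> =
     (let G = estimate_matrix S l \<omega>
      in column k (G ** matrix_inv (conj_transpose G ** G)))"

definition zf_precoder ::
    "('w, 'l :: finite, 'k :: finite, 'm :: finite) mimo \<Rightarrow> 'l \<Rightarrow> 'k \<Rightarrow> 'w \<Rightarrow> complex ^ 'm" where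
  "zf_precoder S l k \<omega> =
     (1 / sqrt (\<integral>\<omega>'. (norm (zf_direction S l k \<omega>'))\<^sup>2 \<partial>pspace S)) *\<^sub>R zf_direction S l k \<omega>"

text \<open>
  \<open>channel_gain S l k l' k'\<close> is the effective gain from the signal that BS \<open>l'\<close> sends to its user
  \<open>k'\<close>, as seen by user \<open>k\<close> of cell \<open>l\<close>.
\<close>

definition channel_gain ::
    "('w, 'l :: finite, 'k :: finite, 'm :: finite) mimo
      \<Rightarrow> 'l \<Rightarrow> 'k \<Rightarrow> 'l \<Rightarrow> 'k \<Rightarrow> 'w \<Rightarrow> complex" where
  "channel_gain S l k l' k' \<omega> =
     complex_of_real (sqrt (max_power S)) *
       (\<Sum>i\<in>UNIV. cnj (channel S l' l k \<omega> $ i) * zf_precoder S l' k' \<omega> $ i)"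

definition interference ::
    "('w, 'l :: finite, 'k :: finite, 'm :: finite) mimo \<Rightarrow> 'l \<Rightarrow> 'k \<Rightarrow> real" where
  "interference S l k =
     (\<Sum>k'\<in>UNIV - {k}. power_coeff S l k' *
        (\<integral>\<omega>. (cmod (channel_gain S l k l k' \<omega>))\<^sup>2 \<partial>pspace S))
     + (\<Sum>l'\<in>UNIV - {l}. \<Sum>k'\<in>UNIV. power_coeff S l' k' *
        (\<integral>\<omega>. (cmod (channel_gain S l k l' k' \<omega>))\<^sup>2 \<partial>pspace S))
     + dl_noise_var S"

text \<open>
  In the next two definitions \<open>\<tau>\<^sub>c\<close> is the length of a coherence interval, whose symbols
  \<open>pilot_len S, ..., \<tau>\<^sub>c - 1\<close> are its data part, and \<open>y\<close> is the signal received by the user.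
\<close>

definition sample_power ::
    "('w, 'l :: finite, 'k :: finite, 'm :: finite) mimo \<Rightarrow> nat \<Rightarrow> (nat \<Rightarrow> complex) \<Rightarrow> real" where
  "sample_power S \<tau>\<^sub>c y =
     1 / (real \<tau>\<^sub>c - real (pilot_len S)) * (\<Sum>n\<in>{pilot_len S..<\<tau>\<^sub>c}. (cmod (y n))\<^sup>2)"

definition gain_estimate ::
    "('w, 'l :: finite, 'k :: finite, 'm :: finite) mimo
      \<Rightarrow> 'l \<Rightarrow> 'k \<Rightarrow> nat \<Rightarrow> real \<Rightarrow> (nat \<Rightarrow> complex) \<Rightarrow> complex" where
  "gain_estimate S l k \<tau>\<^sub>c \<Theta> y =
     (if sample_power S \<tau>\<^sub>c y > \<Theta>
      then complex_of_real (sqrt ((sample_power S \<tau>\<^sub>c y - interference S l k) / power_coeff S l k))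
      else (\<integral>\<omega>. channel_gain S l k l k \<omega> \<partial>pspace S))"

end

theory Submission
  imports Defs "HOL-Real_Asymp.Real_Asymp"
begin

text \<open>
  Fix a base station \<open>b\<close> and a user \<open>(l, k)\<close> with channel \<open>g\<close> of variance \<open>\<beta>\<close> to \<open>b\<close>. If \<open>l\<close> shares
  the pilots of cell \<open>b\<close>, then \<open>g\<close> is a real multiple of the estimate of user \<open>k\<close> of cell \<open>b\<close> plus
  an error of variance \<open>\<beta> - \<gamma>\<close> that is independent of all estimates at \<open>b\<close>; otherwise \<open>g\<close> itself is
  independent of them. A zero-forcing direction \<open>z\<close> of \<open>b\<close> has inner product \<open>1\<close> with its own estimate
  and \<open>0\<close> with the others, so the error contributes \<open>(\<beta> - \<gamma>) * E |z|^2\<close> to the mean squared gain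
  and the estimate contributes a constant for \<open>k' = k\<close> only.

  It remains to compute \<open>E |z|^2\<close>. The length of \<open>z\<close> is the inverse of the distance of its own
  estimate to the span of the \<open>K - 1\<close> others. Given these, rotation invariance makes the squared
  distance a sum of \<open>M - K + 1\<close> squared moduli of independent complex Gaussians, whose inverse has
  mean \<open>1 / (M - K)\<close> times the inverse of the variance.
\<close>

subsection \<open>Rotation invariance of Lebesgue measure\<close>

lemma nn_integral_lborel_translate:
  fixes g :: "'a::euclidean_space \<Rightarrow> ennreal"
  assumes [measurable]: "g \<in> borel_measurable borel"
  shows "(\<integral>\<^sup>+x. g (x + c) \<partial>lborel) = (\<integral>\<^sup>+x. g x \<partial>lborel)"
proof -
  have "(\<integral>\<^sup>+x. g x \<partial>lborel) = (\<integral>\<^sup>+x. g x \<partial>distr lborel borel ((+) c))"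
    by (simp add: lborel_distr_plus)
  also have "\<dots> = (\<integral>\<^sup>+x. g (x + c) \<partial>lborel)"
    by (subst nn_integral_distr) (simp_all add: add.commute)
  finally show ?thesis by simp
qed

text \<open>The integrand factors over the coordinates, so the value is a power of
  \<open>sqrt pi\<close>. A finite nonzero value can be cancelled, as the next proof
  requires.\<close>

lemma nn_integral_exp_neg_norm_sq_finite:
  "(\<integral>\<^sup>+x. ennreal (exp (- (norm (x::'a::euclidean_space))\<^sup>2)) \<partial>lborel) \<notin> {0, \<infinity>}"
proof -
  have "(\<integral>\<^sup>+x. ennreal (exp (- (norm (x::'a))\<^sup>2)) \<partial>lborel)
      = (\<integral>\<^sup>+x. (\<Prod>b\<in>Basis. ennreal (exp (- ((x::'a) \<bullet> b)\<^sup>2))) \<partial>lborel)"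
    by (simp add: prod_ennreal exp_sum[symmetric] norm_eq_sqrt_inner sum_negf
        euclidean_inner[of "x" "x" for x :: 'a] power2_eq_square[symmetric] sum_nonneg)
  also have "\<dots> = (\<Prod>b\<in>(Basis :: 'a set). (\<integral>\<^sup>+x. ennreal (exp (- x\<^sup>2)) \<partial>lborel))"
    by (rule nn_integral_lborel_prod) auto
  also have "(\<integral>\<^sup>+x. ennreal (exp (- x\<^sup>2)) \<partial>lborel) = ennreal (sqrt pi)"
  proof -
    have "(\<integral>\<^sup>+x. ennreal (exp (- x\<^sup>2)) \<partial>lborel)
        = (\<integral>\<^sup>+x. ennreal (sqrt pi) * ennreal (normal_density 0 (sqrt (1/2)) x) \<partial>lborel)"
      by (rule nn_integral_cong) (simp add: ennreal_mult[symmetric] normal_density_def)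
    also have "\<dots> = ennreal (sqrt pi) * ennreal (\<integral>x. normal_density 0 (sqrt (1/2)) x \<partial>lborel)"
      by (subst nn_integral_cmult, simp, subst nn_integral_eq_integral) auto
    finally show ?thesis by simp
  qed
  finally show ?thesis by (simp add: ennreal_power)
qed

text \<open>
  The usual proof of uniqueness of Haar measure: Fubini is applied to
  \<open>g (f x) * h y\<close> with the radial weight \<open>h\<close>.
\<close>

lemma nn_integral_lborel_isometry:
  fixes f :: "'a::euclidean_space \<Rightarrow> 'a"
  assumes f: "linear f" and nf: "\<And>x. norm (f x) = norm x"
    and g[measurable]: "g \<in> borel_measurable borel"
  shows "(\<integral>\<^sup>+x. g (f x) \<partial>lborel) = (\<integral>\<^sup>+x. g x \<partial>lborel)"
proof -
  define h :: "'a \<Rightarrow> ennreal" where "h x = ennreal (exp (- (norm x)\<^sup>2))" for x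
  have [measurable]: "h \<in> borel_measurable borel" unfolding h_def by measurable
  have [measurable]: "f \<in> borel_measurable borel"
    by (intro borel_measurable_continuous_onI linear_continuous_on linear_conv_bounded_linear[THEN iffD1] f)
  have surj: "\<exists>x. f x = y" for y
    using orthogonal_transformation_surj[of f] f nf by (metis orthogonal_transformation surjD)
  define I where "I = (\<integral>\<^sup>+x. h x \<partial>lborel)"
  have I: "I \<noteq> 0" "I \<noteq> \<infinity>"
    using nn_integral_exp_neg_norm_sq_finite[where 'a='a] by (auto simp: I_def h_def)
  \<comment> \<open>\<open>f\<close> is onto, so a shift of \<open>f x\<close> comes from a shift of
    \<open>x\<close>.\<close>
  have tr: "(\<integral>\<^sup>+x. u (f x + y) \<partial>lborel) = (\<integral>\<^sup>+x. u (f x) \<partial>lborel)"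
    if [measurable]: "u \<in> borel_measurable borel" for u :: "'a \<Rightarrow> ennreal" and y
  proof -
    obtain z where "f z = y" using surj by blast
    then have "(\<integral>\<^sup>+x. u (f x + y) \<partial>lborel) = (\<integral>\<^sup>+x. u (f (x + z)) \<partial>lborel)"
      by (simp add: linear_add[OF f])
    also have "\<dots> = (\<integral>\<^sup>+x. u (f x) \<partial>lborel)"
      by (rule nn_integral_lborel_translate) simp
    finally show ?thesis .
  qed
  \<comment> \<open>\<open>h\<close> is even and depends on the norm only, so neither the reflection
    nor \<open>f\<close> is visible; \<open>tr\<close> absorbs the shift.\<close>
  have hf: "(\<integral>\<^sup>+x. h (y - f x) \<partial>lborel) = I" for y
  proof -
    have "(\<integral>\<^sup>+x. h (y - f x) \<partial>lborel) = (\<integral>\<^sup>+x. h (f x + (- y)) \<partial>lborel)"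
      by (simp add: h_def norm_minus_commute)
    also have "\<dots> = (\<integral>\<^sup>+x. h (f x) \<partial>lborel)" by (rule tr) simp
    also have "\<dots> = I" by (simp add: I_def h_def nf)
    finally show ?thesis .
  qed
  have "(\<integral>\<^sup>+x. g (f x) \<partial>lborel) * I = (\<integral>\<^sup>+y. \<integral>\<^sup>+x. g (f x) * h y \<partial>lborel \<partial>lborel)"
    by (simp add: nn_integral_multc nn_integral_cmult I_def)
  \<comment> \<open>The argument of \<open>g\<close> is shifted by \<open>y\<close> here, and
    \<open>y\<close> by \<open>- f x\<close> two steps later. This moves \<open>f\<close> from
    \<open>g\<close> into \<open>h\<close>, where \<open>hf\<close> removes it.\<close>
  also have "\<dots> = (\<integral>\<^sup>+y. \<integral>\<^sup>+x. g (f x + y) * h y \<partial>lborel \<partial>lborel)"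
    by (simp add: nn_integral_multc tr)
  also have "\<dots> = (\<integral>\<^sup>+x. \<integral>\<^sup>+y. g (f x + y) * h y \<partial>lborel \<partial>lborel)"
    by (rule lborel_pair.Fubini') measurable
  also have "\<dots> = (\<integral>\<^sup>+x. \<integral>\<^sup>+y. g y * h (y - f x) \<partial>lborel \<partial>lborel)"
  proof (rule nn_integral_cong)
    fix x
    show "(\<integral>\<^sup>+y. g (f x + y) * h y \<partial>lborel) = (\<integral>\<^sup>+y. g y * h (y - f x) \<partial>lborel)"
      using nn_integral_lborel_translate[of "\<lambda>y. g y * h (y - f x)" "f x"]
      by (simp add: add.commute)
  qed
  also have "\<dots> = (\<integral>\<^sup>+y. \<integral>\<^sup>+x. g y * h (y - f x) \<partial>lborel \<partial>lborel)"
    by (rule lborel_pair.Fubini'[symmetric]) measurable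
  also have "\<dots> = (\<integral>\<^sup>+y. g y \<partial>lborel) * I"
    by (simp add: nn_integral_cmult nn_integral_multc hf)
  finally show ?thesis
    using I by (simp add: ennreal_mult_cancel_left mult.commute[of _ I])
qed

text \<open>Completing \<open>B\<close> by an orthonormal basis of the complement of its span gives
  as many vectors as \<open>Basis\<close> has; \<open>f\<close> sends each \<open>b\<close> in
  \<open>Basis\<close> to \<open>h b\<close>. Coefficients along \<open>B\<close> thus become
  coordinates, over which Lebesgue measure factors.\<close>

lemma orthonormal_set_rotation:
  fixes B :: "'a::euclidean_space set"
  assumes B: "pairwise orthogonal B" "\<And>u. u \<in> B \<Longrightarrow> norm u = 1"
  obtains f h where "linear f" "\<And>x. norm (f x) = norm (x :: 'a)"
    "inj_on h (Basis :: 'a set)" "B \<subseteq> h ` Basis"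
    "\<And>x b. b \<in> Basis \<Longrightarrow> f x \<bullet> h b = x \<bullet> b"
proof -
  let ?W = "{y. \<forall>x\<in>span B. orthogonal x y}"
  have W: "subspace ?W"
    by (auto simp: subspace_def orthogonal_clauses)
  obtain C where C: "C \<subseteq> ?W" "pairwise orthogonal C" "\<And>x. x \<in> C \<Longrightarrow> norm x = 1"
      "independent C" "card C = dim ?W" "span C = ?W"
    by (rule orthonormal_basis_subspace[OF W]) blast
  have indB: "independent B"
    using B by (intro pairwise_orthogonal_independent) (auto dest: B(2)[of 0])
  then have finB: "finite B" by (rule independent_imp_finite)
  have finC: "finite C" using C(4) by (rule independent_imp_finite)
  have disj: "B \<inter> C = {}"
  proof (rule ccontr)
    assume "B \<inter> C \<noteq> {}"
    then obtain x where "x \<in> B" "x \<in> C" by auto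
    then have "orthogonal x x" using C(1) span_base[of x B] by blast
    then have "x = 0" by (simp add: orthogonal_self)
    with B(2)[OF \<open>x \<in> B\<close>] show False by simp
  qed
  have "dim ?W + dim (span B) = DIM('a)"
    using dim_subspace_orthogonal_to_vectors[of "span B" UNIV] by simp
  then have card: "card (B \<union> C) = card (Basis :: 'a set)"
    using C(5) indB finB finC disj by (simp add: card_Un_disjoint dim_eq_card_independent)
  have orth: "pairwise orthogonal (B \<union> C)"
  proof -
    have "orthogonal x y \<and> orthogonal y x" if "x \<in> B" "y \<in> C" for x y
      using C(1) that span_base[of x B] by (auto simp: orthogonal_commute)
    then show ?thesis
      using B(1) C(2) unfolding pairwise_def by blast
  qed
  have unit: "norm u = 1" if "u \<in> B \<union> C" for u using that B C by auto
  obtain h where h: "bij_betw h (Basis :: 'a set) (B \<union> C)"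
    using finite_same_card_bij[OF finite_Basis _ card[symmetric]] finB finC by auto
  define f where "f x = (\<Sum>b\<in>Basis. (x \<bullet> b) *\<^sub>R h b)" for x :: 'a
  have hh: "h a \<bullet> h b = (if a = b then 1 else 0)" if "a \<in> Basis" "b \<in> Basis" for a b
  proof (cases "a = b")
    case True
    then show ?thesis using that unit[of "h a"] h
      by (auto simp: norm_eq_1 bij_betw_def)
  next
    case False
    then have "h a \<noteq> h b" "h a \<in> B \<union> C" "h b \<in> B \<union> C"
      using h that by (auto simp: bij_betw_def inj_on_def)
    then have "orthogonal (h a) (h b)"
      using orth unfolding pairwise_def by blast
    then show ?thesis using False by (simp add: orthogonal_def)
  qed
  have fh: "f x \<bullet> h b = x \<bullet> b" if b: "b \<in> Basis" for x b
  proof -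
    have "f x \<bullet> h b = (\<Sum>a\<in>Basis. (x \<bullet> a) * (if a = b then 1 else 0))"
      unfolding f_def inner_sum_left using b by (intro sum.cong) (simp_all add: hh)
    also have "\<dots> = x \<bullet> b" using b by (simp add: if_distrib cong: if_cong)
    finally show ?thesis .
  qed
  show thesis
  proof
    show "linear f"
      by (rule linearI) (simp_all add: f_def inner_add_left scaleR_add_left sum.distrib scaleR_sum_right)
    show "norm (f x) = norm x" for x
    proof -
      have "f x \<bullet> f x = (\<Sum>b\<in>Basis. (x \<bullet> b) * (f x \<bullet> h b))"
        by (subst (2) f_def) (simp add: inner_sum_right)
      also have "\<dots> = x \<bullet> x"
        by (subst euclidean_inner[of x x]) (intro sum.cong, simp_all add: fh)
      finally show ?thesis by (simp add: norm_eq_sqrt_inner)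
    qed
    show "inj_on h Basis" "B \<subseteq> h ` Basis" using h by (auto simp: bij_betw_def)
    show "f x \<bullet> h b = x \<bullet> b" if "b \<in> Basis" for x b using that by (rule fh)
  qed
qed

text \<open>The variance \<open>v\<close> of a complex coordinate is shared equally by its real and
  imaginary parts, hence the standard deviation \<open>sqrt (v / 2)\<close>.\<close>

lemma normal_density_half:
  "v > 0 \<Longrightarrow> normal_density 0 (sqrt (v / 2)) r = exp (- r\<^sup>2 / v) / sqrt (pi * v)"
  by (simp add: normal_density_def)

lemma nn_integral_normal_density:
  "0 < \<sigma> \<Longrightarrow> (\<integral>\<^sup>+r. ennreal (normal_density \<mu> \<sigma> r) \<partial>lborel) = 1"
  by (subst nn_integral_eq_integral) auto

text \<open>The isometry carrying coordinate directions to \<open>B\<close> keeps the radial density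
  and makes the integrand a product over coordinates. In other words, coefficients along an
  orthonormal set are independent normals of variance \<open>v / 2\<close>.\<close>

lemma nn_integral_gaussian_orthonormal:
  fixes B :: "'a::euclidean_space set" and \<phi> :: "'a \<Rightarrow> real \<Rightarrow> ennreal"
  assumes v: "v > 0" and B: "pairwise orthogonal B" "\<And>u. u \<in> B \<Longrightarrow> norm u = 1"
    and \<phi>[measurable]: "\<And>u. \<phi> u \<in> borel_measurable borel"
  shows "(\<integral>\<^sup>+x. ennreal (exp (- (norm x)\<^sup>2 / v) / sqrt (pi * v) ^ DIM('a)) * (\<Prod>u\<in>B. \<phi> u (x \<bullet> u)) \<partial>lborel)
       = (\<Prod>u\<in>B. \<integral>\<^sup>+r. ennreal (normal_density 0 (sqrt (v / 2)) r) * \<phi> u r \<partial>lborel)"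
proof -
  obtain f h where f: "linear f" "\<And>x. norm (f x) = norm (x :: 'a)"
    and h: "inj_on h (Basis :: 'a set)" "B \<subseteq> h ` Basis"
    and fh: "\<And>x b. b \<in> Basis \<Longrightarrow> f x \<bullet> h b = x \<bullet> b"
    using orthonormal_set_rotation[OF B] by blast
  define A where "A = {b \<in> Basis. h b \<in> B}"
  have A: "A \<subseteq> Basis" "bij_betw h A B"
    using h by (auto simp: A_def bij_betw_def inj_on_def)
  \<comment> \<open>Padding with \<open>1\<close> outside \<open>A\<close> lets the product run over
    all of \<open>Basis\<close>; the padded coordinates integrate to \<open>1\<close>.\<close>
  define \<psi> where "\<psi> b r = (if b \<in> A then \<phi> (h b) r else 1)" for b and r :: real
  have [measurable]: "\<psi> b \<in> borel_measurable borel" for b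
    unfolding \<psi>_def by (cases "b \<in> A") simp_all
  let ?n = "\<lambda>r. ennreal (normal_density 0 (sqrt (v / 2)) r)"
  have prodB: "(\<Prod>u\<in>B. F u) = (\<Prod>b\<in>A. F (h b))" for F :: "'a \<Rightarrow> ennreal"
    by (rule prod.reindex_bij_betw[OF A(2), symmetric])
  have dens: "ennreal (exp (- (norm x)\<^sup>2 / v) / sqrt (pi * v) ^ DIM('a)) = (\<Prod>b\<in>Basis. ?n (x \<bullet> b))"
    for x :: 'a
  proof -
    have "(\<Prod>b\<in>Basis. normal_density 0 (sqrt (v / 2)) (x \<bullet> b))
        = exp (\<Sum>b\<in>Basis. - (x \<bullet> b)\<^sup>2 / v) / sqrt (pi * v) ^ DIM('a)"
      using v by (simp add: normal_density_half prod_dividef exp_sum)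
    also have "(\<Sum>b\<in>Basis. - (x \<bullet> b)\<^sup>2 / v) = - (norm x)\<^sup>2 / v"
      by (simp add: sum_divide_distrib[symmetric] sum_negf norm_eq_sqrt_inner
          euclidean_inner[of x x] power2_eq_square[symmetric] sum_nonneg)
    finally show ?thesis by (simp add: prod_ennreal)
  qed
  have "finite B"
    using finite_subset[OF h(2)] by simp
  have "(\<integral>\<^sup>+x. ennreal (exp (- (norm x)\<^sup>2 / v) / sqrt (pi * v) ^ DIM('a)) * (\<Prod>u\<in>B. \<phi> u (x \<bullet> u)) \<partial>lborel)
      = (\<integral>\<^sup>+x. ennreal (exp (- (norm (f x))\<^sup>2 / v) / sqrt (pi * v) ^ DIM('a)) * (\<Prod>u\<in>B. \<phi> u (f x \<bullet> u)) \<partial>lborel)"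
    by (rule nn_integral_lborel_isometry[OF f, symmetric]) measurable
  also have "\<dots> = (\<integral>\<^sup>+x. (\<Prod>b\<in>Basis. ?n (x \<bullet> b) * \<psi> b (x \<bullet> b)) \<partial>lborel)"
  proof (rule nn_integral_cong)
    fix x
    have "(\<Prod>u\<in>B. \<phi> u (f x \<bullet> u)) = (\<Prod>b\<in>A. \<psi> b (x \<bullet> b))"
      unfolding prodB using A(1) by (intro prod.cong) (auto simp: \<psi>_def fh)
    also have "\<dots> = (\<Prod>b\<in>Basis. \<psi> b (x \<bullet> b))"
      using A(1) by (intro prod.mono_neutral_left) (auto simp: \<psi>_def)
    finally show "ennreal (exp (- (norm (f x))\<^sup>2 / v) / sqrt (pi * v) ^ DIM('a)) * (\<Prod>u\<in>B. \<phi> u (f x \<bullet> u))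
        = (\<Prod>b\<in>Basis. ?n (x \<bullet> b) * \<psi> b (x \<bullet> b))"
      by (simp only: f(2) dens prod.distrib)
  qed
  also have "\<dots> = (\<Prod>b\<in>Basis. \<integral>\<^sup>+r. ?n r * \<psi> b r \<partial>lborel)"
    by (rule nn_integral_lborel_prod) auto
  also have "\<dots> = (\<Prod>b\<in>A. \<integral>\<^sup>+r. ?n r * \<psi> b r \<partial>lborel)"
    using A(1) v by (intro prod.mono_neutral_right) (auto simp: \<psi>_def nn_integral_normal_density)
  also have "\<dots> = (\<Prod>u\<in>B. \<integral>\<^sup>+r. ?n r * \<phi> u r \<partial>lborel)"
    unfolding prodB by (intro prod.cong) (auto simp: \<psi>_def)
  finally show ?thesis .
qed

subsection \<open>Moments of complex Gaussian vectors\<close>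

lemma sets_complex_gaussian [simp, measurable_cong]: "sets (complex_gaussian v) = sets borel"
  by (simp add: complex_gaussian_def)

lemma space_complex_gaussian [simp]: "space (complex_gaussian v) = UNIV"
  by (simp add: complex_gaussian_def)

lemma complex_gaussian_density:
  assumes "v > 0"
  shows "(complex_gaussian v :: (complex ^ 'm :: finite) measure) =
    density lborel (\<lambda>x. ennreal (exp (- (norm x)\<^sup>2 / v) / sqrt (pi * v) ^ DIM(complex ^ 'm)))"
proof -
  have "sqrt (pi * v) ^ (CARD('m) * 2) = (pi * v) ^ CARD('m)"
    using assms by (simp add: mult.commute[of _ 2] power_mult)
  then show ?thesis using assms by (simp add: complex_gaussian_def)
qed

lemma nn_integral_complex_gaussian_orthonormal:
  fixes B :: "(complex ^ 'm :: finite) set"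
  assumes v: "v > 0" and B: "pairwise orthogonal B" "\<And>u. u \<in> B \<Longrightarrow> norm u = 1"
    and [measurable]: "\<And>u. \<phi> u \<in> borel_measurable borel"
  shows "(\<integral>\<^sup>+x. (\<Prod>u\<in>B. \<phi> u (x \<bullet> u)) \<partial>complex_gaussian v)
       = (\<Prod>u\<in>B. \<integral>\<^sup>+r. ennreal (normal_density 0 (sqrt (v / 2)) r) * \<phi> u r \<partial>lborel)"
proof -
  have "independent B"
    using B by (intro pairwise_orthogonal_independent) (auto dest: B(2)[of 0])
  then have "finite B" by (rule independent_imp_finite)
  then have [measurable]: "(\<lambda>x. \<Prod>u\<in>B. \<phi> u (x \<bullet> u)) \<in> borel_measurable borel"
    by (intro borel_measurable_prod_ennreal measurable_compose[OF _ assms(4)]) auto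
  have "(\<integral>\<^sup>+x. (\<Prod>u\<in>B. \<phi> u (x \<bullet> u)) \<partial>complex_gaussian v)
      = (\<integral>\<^sup>+x. ennreal (exp (- (norm x)\<^sup>2 / v) / sqrt (pi * v) ^ DIM(complex ^ 'm)) * (\<Prod>u\<in>B. \<phi> u (x \<bullet> u)) \<partial>lborel)"
    unfolding complex_gaussian_density[OF v] by (rule nn_integral_density) measurable
  also have "\<dots> = (\<Prod>u\<in>B. \<integral>\<^sup>+r. ennreal (normal_density 0 (sqrt (v / 2)) r) * \<phi> u r \<partial>lborel)"
    by (rule nn_integral_gaussian_orthonormal[OF v B assms(4)])
  finally show ?thesis .
qed

lemma prob_space_complex_gaussian:
  assumes "v \<ge> 0"
  shows "prob_space (complex_gaussian v)"
proof (cases "v = 0")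
  case True
  then show ?thesis by (simp add: complex_gaussian_def prob_space_return)
next
  case False
  \<comment> \<open>For the empty orthonormal set both products are \<open>1\<close>, which gives
    the total mass.\<close>
  then have "(\<integral>\<^sup>+x. 1 \<partial>complex_gaussian v) = 1"
    using assms nn_integral_complex_gaussian_orthonormal[of v "{}" "\<lambda>_ _. 1"] by simp
  then show ?thesis by (intro prob_spaceI) simp
qed

text \<open>A proper real subspace is a Lebesgue null set and the law has a density. This will
  exclude linearly dependent columns.\<close>

lemma AE_complex_gaussian_subspace:
  fixes V :: "(complex ^ 'm :: finite) set"
  assumes v: "v > 0" and V: "subspace V" "dim V < 2 * CARD('m)"
  shows "AE x in complex_gaussian v. x \<notin> V"
proof -
  have "negligible V"
    using V(2) by (intro negligible_lowdim) simp
  moreover have "V \<in> sets borel"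
    using V(1) by (simp add: closed_subspace)
  ultimately have "V \<in> null_sets lborel"
    by (simp add: negligible_iff_null_sets null_sets_def)
  then have "AE x in lborel. x \<notin> V"
    by (rule AE_not_in)
  then show ?thesis
    unfolding complex_gaussian_density[OF v] by (subst AE_density) auto
qed

section \<open>Second moments of affine functions of a Gaussian vector\<close>

lemma nn_integral_normal_affine_sq:
  assumes \<sigma>: "\<sigma> > 0"
  shows "(\<integral>\<^sup>+r. ennreal (normal_density 0 \<sigma> r) * ennreal ((s + \<rho> * r)\<^sup>2) \<partial>lborel)
       = ennreal (s\<^sup>2 + \<rho>\<^sup>2 * \<sigma>\<^sup>2)"
proof -
  let ?n = "normal_density 0 \<sigma>"
  have 1: "has_bochner_integral lborel ?n 1"
    using \<sigma> by (auto simp: has_bochner_integral_iff)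
  have 2: "has_bochner_integral lborel (\<lambda>r. ?n r * r) 0"
    using normal_moment_nz_1[OF \<sigma>, of 0] .
  have 3: "has_bochner_integral lborel (\<lambda>r. ?n r * r\<^sup>2) (\<sigma>\<^sup>2)"
    using integrable_normal_moment[OF \<sigma>, of 0 2] integral_normal_moment_even[OF \<sigma>, of 0 1]
    by (auto simp: has_bochner_integral_iff eval_nat_numeral)
  have "has_bochner_integral lborel
      (\<lambda>r. s\<^sup>2 * ?n r + 2 * s * \<rho> * (?n r * r) + \<rho>\<^sup>2 * (?n r * r\<^sup>2))
      (s\<^sup>2 * 1 + 2 * s * \<rho> * 0 + \<rho>\<^sup>2 * \<sigma>\<^sup>2)"
    by (intro has_bochner_integral_add has_bochner_integral_mult_right 1 2 3)
  also have "(\<lambda>r. s\<^sup>2 * ?n r + 2 * s * \<rho> * (?n r * r) + \<rho>\<^sup>2 * (?n r * r\<^sup>2))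
      = (\<lambda>r. ?n r * (s + \<rho> * r)\<^sup>2)"
    by (simp add: fun_eq_iff power2_eq_square algebra_simps)
  finally have "(\<integral>\<^sup>+r. ennreal (?n r * (s + \<rho> * r)\<^sup>2) \<partial>lborel) = ennreal (s\<^sup>2 * 1 + 2 * s * \<rho> * 0 + \<rho>\<^sup>2 * \<sigma>\<^sup>2)"
    by (subst nn_integral_eq_integral) (auto simp: has_bochner_integral_iff)
  then show ?thesis by (simp add: ennreal_mult)
qed

lemma nn_integral_complex_gaussian_affine_sq:
  fixes z :: "complex ^ 'm :: finite"
  assumes v: "v > 0"
  shows "(\<integral>\<^sup>+x. ennreal ((s + x \<bullet> z)\<^sup>2) \<partial>complex_gaussian v) = ennreal (s\<^sup>2 + v / 2 * (norm z)\<^sup>2)"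
proof (cases "z = 0")
  case True
  interpret prob_space "complex_gaussian v :: (complex ^ 'm) measure"
    using v by (intro prob_space_complex_gaussian) simp
  show ?thesis using True emeasure_space_1 by simp
next
  case False
  \<comment> \<open>Only the component of \<open>x\<close> along \<open>z\<close> matters, so a
    single unit vector serves as the orthonormal set; \<open>z = 0\<close> has no direction and is
    split off.\<close>
  let ?u = "sgn z"
  have u: "norm ?u = 1" using False by (simp add: norm_sgn)
  have z: "x \<bullet> z = norm z * (x \<bullet> ?u)" for x
    using False by (simp add: sgn_div_norm)
  have "(\<integral>\<^sup>+x. ennreal ((s + x \<bullet> z)\<^sup>2) \<partial>complex_gaussian v)
      = (\<integral>\<^sup>+x. (\<Prod>u\<in>{?u}. ennreal ((s + norm z * (x \<bullet> u))\<^sup>2)) \<partial>complex_gaussian v)"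
    unfolding z by simp
  also have "\<dots> = (\<integral>\<^sup>+r. ennreal (normal_density 0 (sqrt (v / 2)) r) * ennreal ((s + norm z * r)\<^sup>2) \<partial>lborel)"
    using v u by (subst nn_integral_complex_gaussian_orthonormal) auto
  also have "\<dots> = ennreal (s\<^sup>2 + v / 2 * (norm z)\<^sup>2)"
    using v by (subst nn_integral_normal_affine_sq) (simp_all add: mult.commute)
  finally show ?thesis .
qed

text \<open>Real and imaginary parts are real affine forms along two vectors of equal length,
  \<open>z\<close> and \<open>- \<i> * z\<close>. Each adds \<open>v / 2\<close> times the squared
  length, and mean zero removes the cross terms.\<close>

lemma nn_integral_complex_gaussian_cmod_sq:
  fixes z :: "complex ^ 'm :: finite"
  assumes v: "v \<ge> 0"
  shows "(\<integral>\<^sup>+x. ennreal ((cmod (a + (\<Sum>i\<in>UNIV. cnj (x $ i) * z $ i)))\<^sup>2) \<partial>complex_gaussian v)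
    = ennreal ((cmod a)\<^sup>2 + v * (norm z)\<^sup>2)"
proof (cases "v = 0")
  case True
  have "(\<lambda>x. ennreal ((cmod (a + (\<Sum>i\<in>UNIV. cnj (x $ i) * z $ i)))\<^sup>2)) \<in> borel_measurable borel"
    by (intro measurable_compose[OF _ measurable_ennreal] borel_measurable_continuous_onI
        continuous_intros)
  then show ?thesis
    using True by (simp add: complex_gaussian_def nn_integral_return)
next
  case False
  then have v: "v > 0" using v by simp
  define z' where "z' = (\<chi> i. - \<i> * z $ i)"
  have nz: "norm z' = norm z"
    by (simp add: z'_def norm_vec_def norm_mult)
  have "(cmod (a + (\<Sum>i\<in>UNIV. cnj (x $ i) * z $ i)))\<^sup>2 = (Re a + x \<bullet> z)\<^sup>2 + (Im a + x \<bullet> z')\<^sup>2" for x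
    by (simp add: cmod_power2 inner_vec_def z'_def inner_complex_def)
  then have "(\<integral>\<^sup>+x. ennreal ((cmod (a + (\<Sum>i\<in>UNIV. cnj (x $ i) * z $ i)))\<^sup>2) \<partial>complex_gaussian v)
     = (\<integral>\<^sup>+x. ennreal ((Re a + x \<bullet> z)\<^sup>2) + ennreal ((Im a + x \<bullet> z')\<^sup>2) \<partial>complex_gaussian v)"
    by simp
  also have "\<dots> = ennreal ((Re a)\<^sup>2 + v / 2 * (norm z)\<^sup>2) + ennreal ((Im a)\<^sup>2 + v / 2 * (norm z)\<^sup>2)"
    using v by (subst nn_integral_add) (auto simp: nn_integral_complex_gaussian_affine_sq nz)
  also have "\<dots> = ennreal ((cmod a)\<^sup>2 + v * (norm z)\<^sup>2)"
    using v by (simp add: ennreal_plus[symmetric] cmod_power2 field_simps del: ennreal_plus)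
  finally show ?thesis .
qed

text \<open>Reduces inverse moments to exponentials, whose Gaussian means are explicit. The
  convention \<open>inverse 0 = top\<close> matches the divergent integral at
  \<open>q = 0\<close>.\<close>

lemma inverse_eq_nn_integral_exp:
  assumes "q \<ge> 0"
  shows "inverse (ennreal q) = (\<integral>\<^sup>+t. ennreal (exp (- (t * q))) * indicator {0..} t \<partial>lborel)"
proof (cases "q = 0")
  case True
  have "ennreal (real n) \<le> emeasure lborel {0::real..}" for n
    using emeasure_mono[of "{0..real n}" "{0::real..}" lborel] by simp
  then have "emeasure lborel {0::real..} = top"
    by (cases "emeasure lborel {0::real..}") (auto, metis not_less reals_Archimedean2)
  with True show ?thesis by simp
next
  case False
  with assms have q: "q > 0" by simp
  have "((\<lambda>t. - exp (- (t * q)) / q) \<longlongrightarrow> 0) at_top"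
    using q by real_asymp
  then have "(\<integral>\<^sup>+t. ennreal (exp (- (t * q))) * indicator {0..} t \<partial>lborel) = ennreal (0 - (- exp (- (0 * q)) / q))"
    using q by (intro nn_integral_FTC_atLeast) (auto intro!: derivative_eq_intros)
  also have "\<dots> = inverse (ennreal q)"
    using q by (simp add: inverse_ennreal divide_inverse)
  finally show ?thesis by simp
qed

text \<open>The exponential factor leaves a normal shape with \<open>1 / v' = 1 / v + t\<close>;
  what remains is the ratio \<open>sqrt (v' / v)\<close> of the normalisations.\<close>

lemma nn_integral_normal_exp:
  assumes v: "v > 0" and t: "t \<ge> 0"
  shows "(\<integral>\<^sup>+r. ennreal (normal_density 0 (sqrt (v / 2)) r) * ennreal (exp (- (t * r\<^sup>2))) \<partial>lborel)
       = ennreal (1 / sqrt (1 + t * v))"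
proof -
  define v' where "v' = v / (1 + t * v)"
  have p: "1 + t * v > 0" using v t by (simp add: add_pos_nonneg)
  then have v': "v' > 0" using v by (simp add: v'_def)
  have s: "sqrt (pi * v') * sqrt (1 + t * v) = sqrt (pi * v)"
    using p by (simp add: v'_def real_sqrt_mult real_sqrt_divide)
  have e: "exp (- r\<^sup>2 / v) * exp (- (t * r\<^sup>2)) = exp (- r\<^sup>2 / v')" for r
    using v p by (simp add: exp_add[symmetric] v'_def field_simps)
  have *: "normal_density 0 (sqrt (v / 2)) r * exp (- (t * r\<^sup>2))
      = 1 / sqrt (1 + t * v) * normal_density 0 (sqrt (v' / 2)) r" for r
    using v v' p e[of r] by (simp add: normal_density_half s[symmetric] mult.commute)
  have "(\<integral>\<^sup>+r. ennreal (normal_density 0 (sqrt (v / 2)) r) * ennreal (exp (- (t * r\<^sup>2))) \<partial>lborel)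
      = (\<integral>\<^sup>+r. ennreal (1 / sqrt (1 + t * v)) * ennreal (normal_density 0 (sqrt (v' / 2)) r) \<partial>lborel)"
    using p by (intro nn_integral_cong) (simp add: ennreal_mult[symmetric] * del: times_divide_eq_left)
  also have "\<dots> = ennreal (1 / sqrt (1 + t * v))"
    using v' by (subst nn_integral_cmult) (auto simp: nn_integral_normal_density)
  finally show ?thesis .
qed

text \<open>
  The inverse moment is the integral over \<open>t \<ge> 0\<close> of the Laplace transform
  \<open>1 / (1 + t * v) ^ (r + 1)\<close> of the squared length of the projection onto \<open>span B\<close>.
\<close>

lemma nn_integral_complex_gaussian_inverse_norm_sq:
  fixes B :: "(complex ^ 'm :: finite) set"
  assumes v: "v > 0" and B: "pairwise orthogonal B" "\<And>u. u \<in> B \<Longrightarrow> norm u = 1"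
    and card: "card B = 2 * (r + 1)" and r: "r \<ge> 1"
  shows "(\<integral>\<^sup>+x. inverse (ennreal (\<Sum>u\<in>B. (x \<bullet> u)\<^sup>2)) \<partial>complex_gaussian v)
       = ennreal (1 / (v * real r))"
proof -
  interpret prob_space "complex_gaussian v :: (complex ^ 'm) measure"
    using v by (intro prob_space_complex_gaussian) simp
  interpret pair_sigma_finite "complex_gaussian v :: (complex ^ 'm) measure" "lborel :: real measure"
    by standard
  have finB: "finite B" using card by (rule_tac card_ge_0_finite) simp
  have "(\<integral>\<^sup>+x. inverse (ennreal (\<Sum>u\<in>B. (x \<bullet> u)\<^sup>2)) \<partial>complex_gaussian v)
      = (\<integral>\<^sup>+x. \<integral>\<^sup>+t. ennreal (exp (- (t * (\<Sum>u\<in>B. (x \<bullet> u)\<^sup>2)))) * indicator {0..} t \<partial>lborel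
          \<partial>complex_gaussian v)"
    by (intro nn_integral_cong inverse_eq_nn_integral_exp sum_nonneg) simp
  also have "\<dots> = (\<integral>\<^sup>+t. \<integral>\<^sup>+x. ennreal (exp (- (t * (\<Sum>u\<in>B. (x \<bullet> u)\<^sup>2)))) * indicator {0..} t
          \<partial>complex_gaussian v \<partial>lborel)"
    by (rule Fubini'[symmetric]) measurable
  also have "\<dots> = (\<integral>\<^sup>+t. ennreal (1 / (1 + t * v) ^ (r + 1)) * indicator {0..} t \<partial>lborel)"
  proof (rule nn_integral_cong)
    fix t :: real
    show "(\<integral>\<^sup>+x. ennreal (exp (- (t * (\<Sum>u\<in>B. (x \<bullet> u)\<^sup>2)))) * indicator {0..} t \<partial>complex_gaussian v)
      = ennreal (1 / (1 + t * v) ^ (r + 1)) * indicator {0..} t"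
    proof (cases "t \<ge> 0")
      case True
      then have p: "1 + t * v > 0" using v by (simp add: add_pos_nonneg)
      have "(\<integral>\<^sup>+x. ennreal (exp (- (t * (\<Sum>u\<in>B. (x \<bullet> u)\<^sup>2)))) \<partial>complex_gaussian v)
          = (\<integral>\<^sup>+x. (\<Prod>u\<in>B. ennreal (exp (- (t * (x \<bullet> u)\<^sup>2)))) \<partial>complex_gaussian v)"
        using finB by (simp add: prod_ennreal exp_sum[symmetric] sum_negf sum_distrib_left)
      also have "\<dots> = (\<Prod>u\<in>B. ennreal (1 / sqrt (1 + t * v)))"
        using v True B by (subst nn_integral_complex_gaussian_orthonormal)
          (auto simp: nn_integral_normal_exp)
      also have "\<dots> = ennreal ((1 / sqrt (1 + t * v)) ^ card B)"
        using p by (simp add: ennreal_power)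
      also have "\<dots> = ennreal (1 / (sqrt (1 + t * v) ^ 2) ^ (r + 1))"
        unfolding card power_mult by (simp only: power_one_over)
      finally show ?thesis using p True by simp
    qed simp
  qed
  \<comment> \<open>The antiderivative \<open>- 1 / (v * r * (1 + t * v) ^ r)\<close> vanishes at
    infinity because \<open>r \<ge> 1\<close>, so only its value at \<open>0\<close>
    remains.\<close>
  also have "\<dots> = ennreal (0 - (- (1 / (v * real r)) * inverse ((1 + 0 * v) ^ r)))"
  proof (rule nn_integral_FTC_atLeast)
    show "((\<lambda>t. - (1 / (v * real r)) * inverse ((1 + t * v) ^ r)) \<longlongrightarrow> 0) at_top"
      using v r by real_asymp
    show "DERIV (\<lambda>t. - (1 / (v * real r)) * inverse ((1 + t * v) ^ r)) t :> 1 / (1 + t * v) ^ (r + 1)"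
      if "0 \<le> t" for t
    proof -
      define w where "w = 1 + t * v"
      have w: "w > 0" using v that by (simp add: w_def add_pos_nonneg)
      obtain k where k: "r = Suc k" using r by (cases r) auto
      have "DERIV (\<lambda>t. 1 + t * v) t :> v" by (auto intro!: derivative_eq_intros)
      then have "DERIV (\<lambda>t. inverse ((1 + t * v) ^ r)) t :> - ((real r * (v * w ^ k)) * inverse ((w ^ r) ^ 2))"
        using w DERIV_inverse_fun[OF DERIV_power[of "\<lambda>t. 1 + t * v" v t UNIV r]]
        by (simp add: w_def k numeral_2_eq_2 mult.commute)
      from DERIV_cmult[OF this, of "- (1 / (v * real r))"]
      have "DERIV (\<lambda>t. - (1 / (v * real r)) * inverse ((1 + t * v) ^ r)) t
          :> - (1 / (v * real r)) * - ((real r * (v * w ^ k)) * inverse ((w ^ r) ^ 2))" .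
      also have "- (1 / (v * real r)) * - ((real r * (v * w ^ k)) * inverse ((w ^ r) ^ 2))
          = w ^ k * inverse ((w ^ r) ^ 2)"
        using v r by simp
      also have "\<dots> = 1 / (1 + t * v) ^ (r + 1)"
        using w by (simp add: w_def[symmetric] k power2_eq_square divide_inverse)
      finally show ?thesis .
    qed
  qed (use v in \<open>auto simp: add_nonneg_nonneg\<close>)
  finally show ?thesis by simp
qed

text \<open>
  Completing the square in the joint density of \<open>g\<close> and \<open>y = c * g + w\<close> shows that the
  estimation error \<open>e = g - (c * a / v) * y\<close> is independent of \<open>y\<close>.
\<close>

lemma nn_integral_complex_gaussian_linear_observation:
  fixes f :: "complex ^ 'm :: finite \<Rightarrow> complex ^ 'm \<Rightarrow> ennreal" and c :: real
  assumes a: "a \<ge> 0" and s: "s > 0"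
    and [measurable]: "case_prod f \<in> borel_measurable (borel \<Otimes>\<^sub>M borel)"
  defines "v \<equiv> c\<^sup>2 * a + s"
  shows "(\<integral>\<^sup>+g. \<integral>\<^sup>+w. f g (c *\<^sub>R g + w) \<partial>complex_gaussian s \<partial>complex_gaussian a)
    = (\<integral>\<^sup>+y. \<integral>\<^sup>+e. f (e + (c * a / v) *\<^sub>R y) y \<partial>complex_gaussian (a * s / v) \<partial>complex_gaussian v)"
proof -
  have [measurable]: "(\<lambda>x. f (g x) (h x)) \<in> borel_measurable M"
    if "g \<in> borel_measurable M" "h \<in> borel_measurable M" for g h and M :: "'x measure"
    using measurable_compose[OF measurable_Pair[OF that] assms(3)] by simp
  have v: "v > 0" using a s by (simp add: v_def add_nonneg_pos)
  show ?thesis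
  \<comment> \<open>For \<open>a = 0\<close> there is no density: the channel is \<open>0\<close>
    and the observation is the noise alone.\<close>
  proof (cases "a = 0")
    case True
    interpret prob_space "complex_gaussian s :: (complex ^ 'm) measure"
      using s by (intro prob_space_complex_gaussian) simp
    show ?thesis
      using True by (simp add: v_def complex_gaussian_def[of 0] nn_integral_return)
  next
    case False
    with a have a: "a > 0" by simp
    let ?w = "a * s / v" and ?d = "c * a / v"
    have w: "?w > 0" using a s v by simp
    let ?D = "\<lambda>t (x :: complex ^ 'm). ennreal (exp (- (norm x)\<^sup>2 / t) / sqrt (pi * t) ^ DIM(complex ^ 'm))"
    have int: "(\<integral>\<^sup>+x. h x \<partial>complex_gaussian t) = (\<integral>\<^sup>+x. ?D t x * h x \<partial>lborel)"
      if "t > 0" "h \<in> borel_measurable borel" for t and h :: "complex ^ 'm \<Rightarrow> ennreal"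
      unfolding complex_gaussian_density[OF that(1)] using that(2) by (subst nn_integral_density) auto
    \<comment> \<open>The joint density in the new variables \<open>y\<close> and \<open>e\<close>.
      The MMSE coefficient \<open>?d\<close> is the one for which the mixed term in \<open>e\<close>
      and \<open>y\<close> cancels.\<close>
    have prod: "?D a (e + ?d *\<^sub>R y) * ?D s (y - c *\<^sub>R (e + ?d *\<^sub>R y)) = ?D v y * ?D ?w e" for e y
    proof -
      have cd: "c * ?d = 1 - s / v" using v by (simp add: v_def power2_eq_square field_simps)
      have "y - c *\<^sub>R (e + ?d *\<^sub>R y) = y - (c *\<^sub>R e + (c * ?d) *\<^sub>R y)"
        by (simp only: scaleR_add_right scaleR_scaleR)
      also have "\<dots> = (s / v) *\<^sub>R y - c *\<^sub>R e"
        unfolding cd scaleR_diff_left by simp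
      finally have y: "y - c *\<^sub>R (e + ?d *\<^sub>R y) = (s / v) *\<^sub>R y - c *\<^sub>R e" .
      have "(norm (e + ?d *\<^sub>R y))\<^sup>2 / a + (norm (y - c *\<^sub>R (e + ?d *\<^sub>R y)))\<^sup>2 / s
          = (norm e)\<^sup>2 * (1 / a + c\<^sup>2 / s) + 2 * (e \<bullet> y) * (?d / a - c * (s / v) / s)
            + (norm y)\<^sup>2 * (?d\<^sup>2 / a + (s / v)\<^sup>2 / s)"
        unfolding y power2_norm_eq_inner
        by (simp add: inner_add_left inner_add_right inner_diff_left inner_diff_right inner_commute
            power2_eq_square add_divide_distrib diff_divide_distrib algebra_simps)
      also have "1 / a + c\<^sup>2 / s = 1 / ?w"
        using a s v by (simp add: v_def field_simps)
      also have "?d / a - c * (s / v) / s = 0"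
        using a s by simp
      also have "?d\<^sup>2 / a + (s / v)\<^sup>2 / s = (c\<^sup>2 * a + s) / v\<^sup>2"
        using a s by (simp add: power2_eq_square add_divide_distrib)
      also have "\<dots> = 1 / v"
        unfolding v_def[symmetric] using v by (simp add: power2_eq_square)
      finally have e: "- (norm (e + ?d *\<^sub>R y))\<^sup>2 / a + - (norm (y - c *\<^sub>R (e + ?d *\<^sub>R y)))\<^sup>2 / s
          = - (norm y)\<^sup>2 / v + - (norm e)\<^sup>2 / ?w"
        by simp
      have n: "sqrt (pi * a) * sqrt (pi * s) = sqrt (pi * v) * sqrt (pi * ?w)"
        unfolding real_sqrt_mult[symmetric] using v by simp
      have "exp (- (norm (e + ?d *\<^sub>R y))\<^sup>2 / a) / sqrt (pi * a) ^ n *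
            (exp (- (norm (y - c *\<^sub>R (e + ?d *\<^sub>R y)))\<^sup>2 / s) / sqrt (pi * s) ^ n)
          = exp (- (norm y)\<^sup>2 / v) / sqrt (pi * v) ^ n * (exp (- (norm e)\<^sup>2 / ?w) / sqrt (pi * ?w) ^ n)" for n
        unfolding times_divide_times_eq exp_add[symmetric] power_mult_distrib[symmetric] e n ..
      then show ?thesis
        using a s v w by (simp only: ennreal_mult[symmetric] zero_le_divide_iff exp_ge_zero
            real_sqrt_ge_zero zero_le_power mult_nonneg_nonneg pi_ge_zero less_imp_le simp_thms)
    qed
    have "(\<integral>\<^sup>+g. \<integral>\<^sup>+w. f g (c *\<^sub>R g + w) \<partial>complex_gaussian s \<partial>complex_gaussian a)
        = (\<integral>\<^sup>+g. \<integral>\<^sup>+w. ?D a g * (?D s w * f g (c *\<^sub>R g + w)) \<partial>lborel \<partial>lborel)"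
      using a s by (simp add: int nn_integral_cmult)
    \<comment> \<open>For fixed \<open>g\<close> the passage from \<open>w\<close> to
      \<open>y\<close>, and later for fixed \<open>y\<close> that from \<open>g\<close> to
      \<open>e\<close>, are translations, so no Jacobian factor appears.\<close>
    also have "\<dots> = (\<integral>\<^sup>+g. \<integral>\<^sup>+y. ?D a g * (?D s (y - c *\<^sub>R g) * f g y) \<partial>lborel \<partial>lborel)"
    proof (rule nn_integral_cong)
      fix g
      show "(\<integral>\<^sup>+w. ?D a g * (?D s w * f g (c *\<^sub>R g + w)) \<partial>lborel)
          = (\<integral>\<^sup>+y. ?D a g * (?D s (y - c *\<^sub>R g) * f g y) \<partial>lborel)"
        using nn_integral_lborel_translate[of "\<lambda>y. ?D a g * (?D s (y - c *\<^sub>R g) * f g y)" "c *\<^sub>R g"]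
        by (simp add: add.commute)
    qed
    also have "\<dots> = (\<integral>\<^sup>+y. \<integral>\<^sup>+g. ?D a g * (?D s (y - c *\<^sub>R g) * f g y) \<partial>lborel \<partial>lborel)"
      by (rule lborel_pair.Fubini') measurable
    also have "\<dots> = (\<integral>\<^sup>+y. \<integral>\<^sup>+e. ?D v y * (?D ?w e * f (e + ?d *\<^sub>R y) y) \<partial>lborel \<partial>lborel)"
    proof (rule nn_integral_cong)
      fix y
      have "(\<integral>\<^sup>+g. ?D a g * (?D s (y - c *\<^sub>R g) * f g y) \<partial>lborel)
          = (\<integral>\<^sup>+e. ?D a (e + ?d *\<^sub>R y) * (?D s (y - c *\<^sub>R (e + ?d *\<^sub>R y)) * f (e + ?d *\<^sub>R y) y) \<partial>lborel)"
        by (rule nn_integral_lborel_translate[symmetric]) measurable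
      also have "\<dots> = (\<integral>\<^sup>+e. ?D v y * (?D ?w e * f (e + ?d *\<^sub>R y) y) \<partial>lborel)"
        unfolding mult.assoc[symmetric] prod ..
      finally show "(\<integral>\<^sup>+g. ?D a g * (?D s (y - c *\<^sub>R g) * f g y) \<partial>lborel) = \<dots>" .
    qed
    also have "\<dots> = (\<integral>\<^sup>+y. \<integral>\<^sup>+e. f (e + ?d *\<^sub>R y) y \<partial>complex_gaussian ?w \<partial>complex_gaussian v)"
      using v w by (simp add: int nn_integral_cmult)
    finally show ?thesis .
  qed
qed

subsection \<open>Zero-forcing columns\<close>

text \<open>\<open>zf_direction\<close> for arbitrary columns in place of the estimates, which
  separates the linear algebra from the probability.\<close>

definition zf_column :: "('k :: finite \<Rightarrow> complex ^ 'm :: finite) \<Rightarrow> 'k \<Rightarrow> complex ^ 'm" where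
  "zf_column g k = (let G = (\<chi> i j. g j $ i) in column k (G ** matrix_inv (conj_transpose G ** G)))"

definition combination :: "('k :: finite \<Rightarrow> complex ^ 'm :: finite) \<Rightarrow> complex ^ 'k \<Rightarrow> complex ^ 'm" where
  "combination g c = (\<Sum>j\<in>UNIV. c $ j *s g j)"

text \<open>The complex span of the columns other than \<open>g k\<close>. It is treated as a real
  subspace, so \<open>dim\<close> below is twice the complex dimension.\<close>

definition others_span :: "('k :: finite \<Rightarrow> complex ^ 'm :: finite) \<Rightarrow> 'k \<Rightarrow> (complex ^ 'm) set" where
  "others_span g k = combination g ` {c. c $ k = 0}"

definition hermitian :: "complex ^ 'm :: finite \<Rightarrow> complex ^ 'm \<Rightarrow> complex" where
  "hermitian x y = (\<Sum>i\<in>UNIV. cnj (x $ i) * y $ i)"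

lemma linear_combination: "linear (combination g)"
  by (rule linearI) (simp_all add: combination_def vec_eq_iff sum.distrib algebra_simps
      scaleR_sum_right scaleR_conv_of_real[where 'a = complex] sum_distrib_left)

lemma combination_mult: "combination g (a *s c) = a *s combination g c"
  by (simp add: combination_def vec_eq_iff sum_distrib_left mult.assoc)

lemma combination_axis: "combination g (axis j 1) = g j"
  by (simp add: combination_def vec_eq_iff axis_def if_distrib if_distribR cong: if_cong)

lemma subspace_coordinate_zero: "subspace {c :: complex ^ 'k :: finite. c $ k = 0}"
  by (auto simp: subspace_def)

lemma dim_coordinate_zero: "dim {c :: complex ^ 'k :: finite. c $ k = 0} = 2 * (CARD('k) - 1)"
proof -
  let ?d = "Basis - {axis k 1, axis k \<i>} :: (complex ^ 'k) set"
  have "{c :: complex ^ 'k. c $ k = 0} = {c. \<forall>i\<in>Basis. i \<notin> ?d \<longrightarrow> c \<bullet> i = 0}"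
    by (auto simp: inner_axis complex_eq_iff inner_complex_def)
  moreover have "card ?d = 2 * (CARD('k) - 1)"
    by (subst card_Diff_subset) (auto simp: axis_eq_axis)
  ultimately show ?thesis
    using dim_substandard[of ?d] by simp
qed

lemma subspace_others_span: "subspace (others_span g k)"
  unfolding others_span_def
  by (rule linear_subspace_image[OF linear_combination subspace_coordinate_zero])

lemma dim_others_span_le: "dim (others_span (g :: 'k :: finite \<Rightarrow> _) k) \<le> 2 * (CARD('k) - 1)"
  unfolding others_span_def
  by (rule order_trans[OF dim_image_le[OF linear_combination]]) (simp add: dim_coordinate_zero)

lemma dim_others_span:
  assumes "inj (combination g)"
  shows "dim (others_span (g :: 'k :: finite \<Rightarrow> _) k) = 2 * (CARD('k) - 1)"
  unfolding others_span_def
  by (subst dim_image_eq[OF linear_combination])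
    (auto simp: dim_coordinate_zero intro: inj_on_subset[OF assms])

text \<open>Combinations with coefficient \<open>0\<close> at \<open>k\<close> ignore
  \<open>g k\<close>. This allows integrating over column \<open>k\<close> with the span held
  fixed.\<close>

lemma others_span_upd [simp]: "others_span (g(k := x)) k = others_span g k"
proof -
  have "combination (g(k := x)) c = combination g c" if "c $ k = 0" for c
    unfolding combination_def using that by (intro sum.cong) auto
  then show ?thesis unfolding others_span_def by (auto intro!: image_cong)
qed

lemma others_span_mult:
  assumes "x \<in> others_span g k"
  shows "a *s x \<in> others_span g k"
proof -
  obtain c where "c $ k = 0" "x = combination g c" using assms by (auto simp: others_span_def)
  then have "a *s x = combination g (a *s c)" "(a *s c) $ k = 0" by (simp_all add: combination_mult)
  then show ?thesis unfolding others_span_def by blast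
qed

lemma column_in_others_span: "j \<noteq> k \<Longrightarrow> g j \<in> others_span g k"
  unfolding others_span_def
  by (rule image_eqI[of _ _ "axis j 1"]) (simp_all add: combination_axis, simp add: axis_def)

text \<open>In a nontrivial relation some coefficient \<open>c $ k\<close> is nonzero, and dividing
  by it expresses \<open>g k\<close> through the other columns.\<close>

lemma inj_combination:
  assumes "\<And>k. g k \<notin> others_span g k"
  shows "inj (combination g)"
proof -
  have "c = 0" if c: "combination g c = 0" for c
  proof (rule ccontr)
    assume "c \<noteq> 0"
    then obtain k where k: "c $ k \<noteq> 0" by (auto simp: vec_eq_iff)
    let ?c = "axis k 1 - inverse (c $ k) *s c"
    have "combination g ?c = g k"
      by (simp add: linear_diff[OF linear_combination] combination_axis combination_mult c)
    moreover have "?c $ k = 0" using k by simp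
    ultimately have "g k \<in> others_span g k" unfolding others_span_def by (metis (mono_tags, lifting) image_eqI mem_Collect_eq)
    with assms show False by blast
  qed
  then show ?thesis
    using linear_injective_0[OF linear_combination] by blast
qed

section \<open>Hermitian inner products\<close>

lemma hermitian_add_left: "hermitian (x + y) z = hermitian x z + hermitian y z"
  by (simp add: hermitian_def algebra_simps sum.distrib)

lemma hermitian_mult_left: "hermitian (a *s x) z = cnj a * hermitian x z"
  by (simp add: hermitian_def sum_distrib_left mult_ac)

lemma hermitian_sum_left: "hermitian (\<Sum>j\<in>A. f j) z = (\<Sum>j\<in>A. hermitian (f j) z)"
  by (simp add: hermitian_def sum_distrib_right sum.swap[of _ A])

lemma Re_hermitian: "Re (hermitian x y) = x \<bullet> y"
  by (simp add: hermitian_def inner_vec_def inner_complex_def)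

lemma hermitian_self: "hermitian x x = of_real ((norm x)\<^sup>2)"
  by (simp add: hermitian_def power2_norm_eq_inner inner_vec_def mult.commute
      complex_norm_square[symmetric] flip: of_real_sum)

text \<open>Real orthogonality suffices because the span is closed under multiplication by
  \<open>\<i>\<close>: testing with \<open>\<i> *s x\<close> gives the imaginary part.\<close>

lemma hermitian_others_span_eq_0:
  assumes x: "x \<in> others_span g k" and p: "\<And>y. y \<in> others_span g k \<Longrightarrow> y \<bullet> p = 0"
  shows "hermitian x p = 0"
proof (rule complex_eqI)
  show "Re (hermitian x p) = Re 0" using p[OF x] by (simp add: Re_hermitian)
  have "Re (hermitian (\<i> *s x) p) = 0"
    using p[OF others_span_mult[OF x, of \<i>]] by (simp only: Re_hermitian)
  then show "Im (hermitian x p) = Im 0" by (simp add: hermitian_mult_left)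
qed

lemma column_eq_mult: "column k M = M *v axis k (1 :: complex)"
  by (simp add: column_def matrix_vector_mult_def axis_def vec_eq_iff if_distrib if_distribR cong: if_cong)

context
  fixes g :: "'k :: finite \<Rightarrow> complex ^ 'm :: finite" and G :: "complex ^ 'k ^ 'm"
    and A :: "complex ^ 'k ^ 'k"
  assumes inj: "inj (combination g)"
  defines "G \<equiv> \<chi> i j. g j $ i"
  defines "A \<equiv> conj_transpose G ** G"
begin

lemma G_mult: "G *v c = combination g c"
  by (simp add: G_def combination_def matrix_vector_mult_def vec_eq_iff mult.commute)

lemma conj_transpose_G_mult: "conj_transpose G *v x = (\<chi> j. hermitian (g j) x)"
  by (simp add: G_def hermitian_def conj_transpose_def matrix_vector_mult_def vec_eq_iff)

text \<open>The quadratic form of the Gram matrix is the squared norm of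
  \<open>combination g c\<close>, so its kernel is trivial for independent columns.\<close>

lemma gram_inverse: "matrix_inv A ** A = mat 1" "A ** matrix_inv A = mat 1"
proof -
  have "c = 0" if "A *v c = 0" for c
  proof -
    have h: "hermitian (g j) (combination g c) = 0" for j
      using that by (simp add: A_def matrix_vector_mul_assoc[symmetric] G_mult conj_transpose_G_mult vec_eq_iff)
    have "hermitian (combination g c) (combination g c) = 0"
      by (subst combination_def) (simp add: hermitian_sum_left hermitian_mult_left h)
    then have "combination g c = 0" by (simp add: hermitian_self)
    then show ?thesis using linear_injective_0[OF linear_combination] inj by blast
  qed
  then have "invertible A"
    by (simp add: invertible_left_inverse matrix_left_invertible_ker)
  then have "\<exists>B. A ** B = mat 1 \<and> B ** A = mat 1" by (simp add: invertible_def)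
  from someI_ex[OF this] show "matrix_inv A ** A = mat 1" "A ** matrix_inv A = mat 1"
    by (simp_all add: matrix_inv_def)
qed

lemma zf_column_eq: "zf_column g k = G *v (matrix_inv A *v axis k 1)"
  by (simp add: zf_column_def Let_def A_def column_eq_mult matrix_vector_mul_assoc matrix_mul_assoc flip: G_def)

text \<open>The zero-forcing property: the conjugate transpose of \<open>G\<close> times
  \<open>G ** matrix_inv A\<close> is the identity.\<close>

lemma hermitian_zf_column: "hermitian (g j) (zf_column g k) = (if j = k then 1 else 0)"
proof -
  have "conj_transpose G *v zf_column g k = (A ** matrix_inv A) *v axis k 1"
    by (simp add: zf_column_eq A_def matrix_vector_mul_assoc matrix_mul_assoc)
  then have "hermitian (g j) (zf_column g k) = axis k 1 $ j"
    by (simp add: gram_inverse conj_transpose_G_mult vec_eq_iff)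
  then show ?thesis by (simp add: axis_def)
qed

text \<open>
  The zero-forcing column is the residual \<open>p\<close> of \<open>g k\<close> after projection onto the span of the
  other columns, divided by its squared norm.
\<close>

lemma norm_zf_column:
  assumes B: "pairwise orthogonal B" "\<And>u. u \<in> B \<Longrightarrow> norm u = 1"
    and span: "span B = {y. \<forall>x\<in>others_span g k. orthogonal x y}"
  shows "ennreal ((norm (zf_column g k))\<^sup>2) = inverse (ennreal (\<Sum>u\<in>B. (g k \<bullet> u)\<^sup>2))"
proof -
  have "independent B"
    using B by (intro pairwise_orthogonal_independent) (auto dest: B(2)[of 0])
  then have finB: "finite B" by (rule independent_imp_finite)
  obtain v p where vp: "v \<in> others_span g k" "\<And>w. w \<in> others_span g k \<Longrightarrow> orthogonal p w" "g k = v + p"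
    using orthogonal_subspace_decomp_exists[of "others_span g k" "g k"]
    by (auto simp: span_eq_iff[THEN iffD2, OF subspace_others_span])
  have p0: "y \<bullet> p = 0" if "y \<in> others_span g k" for y
    using vp(2)[OF that] by (simp add: orthogonal_def inner_commute)
  have "p \<in> span B" unfolding span using vp(2) by (auto simp: orthogonal_commute)
  then have "(\<Sum>u\<in>B. (p \<bullet> u) *\<^sub>R u) = p"
    using orthonormal_basis_expand[OF B _ finB] by blast
  then have "(norm p)\<^sup>2 = p \<bullet> (\<Sum>u\<in>B. (p \<bullet> u) *\<^sub>R u)" by (simp add: power2_norm_eq_inner)
  also have "\<dots> = (\<Sum>u\<in>B. (p \<bullet> u)\<^sup>2)" by (simp add: inner_sum_right power2_eq_square)
  \<comment> \<open>The removed part \<open>v\<close> is orthogonal to \<open>B\<close>, so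
    \<open>p\<close> and \<open>g k\<close> have the same coefficients along
    \<open>B\<close>.\<close>
  also have "\<dots> = (\<Sum>u\<in>B. (g k \<bullet> u)\<^sup>2)"
  proof (rule sum.cong[OF refl])
    fix u assume "u \<in> B"
    then have "u \<in> span B" by (rule span_base)
    then have "v \<bullet> u = 0" using vp(1) unfolding span by (auto simp: orthogonal_def)
    then show "(p \<bullet> u)\<^sup>2 = (g k \<bullet> u)\<^sup>2" by (simp add: vp(3) inner_add_left)
  qed
  finally have norm_p: "(norm p)\<^sup>2 = (\<Sum>u\<in>B. (g k \<bullet> u)\<^sup>2)" .
  obtain c where c: "c $ k = 0" "v = combination g c" using vp(1) by (auto simp: others_span_def)
  \<comment> \<open>The coefficient vector of \<open>p\<close>. Its entry at \<open>k\<close> is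
    \<open>1\<close>, so \<open>p\<close> is nonzero by injectivity.\<close>
  let ?c = "axis k 1 - c"
  have Gc: "G *v ?c = p"
    using vp(3) c(2) by (simp add: G_mult linear_diff[OF linear_combination] combination_axis)
  have "?c $ k = 1" using c(1) by simp
  then have "?c \<noteq> 0" by (metis zero_index zero_neq_one)
  then have "p \<noteq> 0"
    using inj linear_injective_0[OF linear_combination, of g] Gc G_mult by metis
  \<comment> \<open>These products are the entries of \<open>A *v ?c\<close>. Hence
    \<open>?c\<close> is, up to the factor \<open>(norm p)\<^sup>2\<close>, the \<open>k\<close>-th
    column of \<open>matrix_inv A\<close>.\<close>
  have "hermitian (g j) p = (if j = k then of_real ((norm p)\<^sup>2) else 0)" for j
  proof (cases "j = k")
    case True
    then show ?thesis
      using hermitian_others_span_eq_0[OF vp(1) p0] by (simp add: vp(3) hermitian_add_left hermitian_self)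
  next
    case False
    then show ?thesis
      using hermitian_others_span_eq_0[OF column_in_others_span p0] by simp
  qed
  then have "A *v ?c = of_real ((norm p)\<^sup>2) *s axis k 1"
    unfolding A_def matrix_vector_mul_assoc[symmetric] Gc conj_transpose_G_mult
    by (simp add: vec_eq_iff axis_def)
  then have "(matrix_inv A ** A) *v ?c = of_real ((norm p)\<^sup>2) *s (matrix_inv A *v axis k 1)"
    by (simp add: matrix_vector_mul_assoc[symmetric] vector_scalar_commute del: of_real_power)
  then have "?c = of_real ((norm p)\<^sup>2) *s (matrix_inv A *v axis k 1)"
    by (simp only: gram_inverse matrix_vector_mul_lid)
  from arg_cong[OF this, of "(*v) G"] have "p = of_real ((norm p)\<^sup>2) *s zf_column g k"
    by (simp only: vector_scalar_commute Gc zf_column_eq)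
  also have "\<dots> = (norm p)\<^sup>2 *\<^sub>R zf_column g k"
    by (simp add: vec_eq_iff scaleR_conv_of_real[where 'a = complex])
  finally have "norm p = (norm p)\<^sup>2 * norm (zf_column g k)"
    by (metis norm_scaleR abs_of_nonneg zero_le_power2)
  then have "norm (zf_column g k) = inverse (norm p)"
    using \<open>p \<noteq> 0\<close> by (simp add: power2_eq_square field_simps)
  then show ?thesis
    using \<open>p \<noteq> 0\<close> by (simp add: norm_p[symmetric] inverse_ennreal power_inverse)
qed

end

lemma others_span_complement_basis:
  fixes g :: "'k :: finite \<Rightarrow> complex ^ 'm :: finite"
  obtains B where "pairwise orthogonal B" "\<And>u. u \<in> B \<Longrightarrow> norm u = 1"
    "span B = {y. \<forall>x\<in>others_span g k. orthogonal x y}"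
    "card B + dim (others_span g k) = 2 * CARD('m)"
proof -
  let ?W = "{y. \<forall>x\<in>others_span g k. orthogonal x y}"
  have "subspace ?W" by (auto simp: subspace_def orthogonal_clauses)
  then obtain B where "pairwise orthogonal B" "\<And>u. u \<in> B \<Longrightarrow> norm u = 1" "span B = ?W" "card B = dim ?W"
    by (rule orthonormal_basis_subspace) blast
  moreover have "dim ?W + dim (others_span g k) = 2 * CARD('m)"
    using dim_subspace_orthogonal_to_vectors[OF subspace_others_span subspace_UNIV, of g k] by simp
  ultimately show thesis using that by simp
qed

subsection \<open>Zero-forcing with independent Gaussian columns\<close>

lemma borel_measurable_vec_lambda [measurable (raw)]:
  fixes f :: "'n :: finite \<Rightarrow> 'a \<Rightarrow> 'b :: euclidean_space"
  assumes "\<And>i. f i \<in> borel_measurable M"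
  shows "(\<lambda>x. \<chi> i. f i x) \<in> borel_measurable M"
  using assms by (subst borel_measurable_euclidean_space) (auto simp: Basis_vec_def inner_axis)

lemma borel_measurable_vec_nth [measurable (raw)]:
  fixes f :: "'a \<Rightarrow> 'b :: euclidean_space ^ 'n :: finite"
  assumes "f \<in> borel_measurable M"
  shows "(\<lambda>x. f x $ i) \<in> borel_measurable M"
  by (rule borel_measurable_continuous_on[OF _ assms]) (intro continuous_intros)

lemma borel_measurable_cnj [measurable (raw)]:
  assumes "f \<in> borel_measurable M"
  shows "(\<lambda>x. cnj (f x)) \<in> borel_measurable M"
  by (rule borel_measurable_continuous_on[OF _ assms]) (intro continuous_intros)

lemma borel_measurable_det [measurable (raw)]:
  fixes f :: "'a \<Rightarrow> complex ^ 'n ^ 'n :: finite"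
  assumes [measurable]: "f \<in> borel_measurable M"
  shows "(\<lambda>x. det (f x)) \<in> borel_measurable M"
  unfolding det_def by measurable

text \<open>On singular matrices \<open>matrix_inv\<close> chooses from an empty predicate, hence
  always the same value. Together with Cramer's rule on the others this makes it measurable.\<close>

lemma matrix_inv_singular:
  fixes A :: "complex ^ 'n ^ 'n :: finite"
  assumes "det A = 0"
  shows "matrix_inv A = (SOME B. False)"
proof -
  have "(A ** B = mat 1 \<and> B ** A = mat 1) = False" for B
    using assms by (metis invertible_def invertible_det_nz)
  then show ?thesis by (simp only: matrix_inv_def)
qed

lemma matrix_inv_cramer:
  fixes A :: "complex ^ 'n ^ 'n :: finite"
  assumes "det A \<noteq> 0"
  shows "matrix_inv A $ i $ j = det (\<chi> r c. if c = i then axis j 1 $ r else A $ r $ c) / det A"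
proof -
  have "\<exists>B. A ** B = mat 1 \<and> B ** A = mat 1"
    using assms by (simp add: invertible_det_nz[symmetric] invertible_def)
  from someI_ex[OF this] have "A ** matrix_inv A = mat 1" by (simp add: matrix_inv_def)
  then have "A *v (matrix_inv A *v axis j 1) = axis j 1"
    by (simp add: matrix_vector_mul_assoc)
  then have "A *v column j (matrix_inv A) = axis j 1" by (simp add: column_eq_mult)
  then have "column j (matrix_inv A) $ i = det (\<chi> r c. if c = i then axis j 1 $ r else A $ r $ c) / det A"
    by (subst (asm) cramer[OF assms]) simp
  then show ?thesis by (simp add: column_def)
qed

lemma borel_measurable_matrix_inv [measurable (raw)]:
  fixes f :: "'a \<Rightarrow> complex ^ 'n ^ 'n :: finite"
  assumes [measurable]: "f \<in> borel_measurable M"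
  shows "(\<lambda>x. matrix_inv (f x)) \<in> borel_measurable M"
proof -
  have eq: "matrix_inv (f x) = (if det (f x) = 0 then (SOME B. False) else
      \<chi> i j. det (\<chi> r c. if c = i then axis j 1 $ r else f x $ r $ c) / det (f x))" for x
    by (simp add: matrix_inv_singular matrix_inv_cramer vec_eq_iff)
  have [measurable]: "(\<lambda>x. if c = i then axis j 1 $ r else f x $ r $ c) \<in> borel_measurable M"
    for c i j r by (cases "c = i") simp_all
  show ?thesis unfolding eq by measurable
qed

lemma borel_measurable_zf_column [measurable (raw)]:
  fixes g :: "'a \<Rightarrow> 'k :: finite \<Rightarrow> complex ^ 'm :: finite"
  assumes [measurable]: "\<And>j. (\<lambda>x. g x j) \<in> borel_measurable M"
  shows "(\<lambda>x. zf_column (g x) k) \<in> borel_measurable M"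
  unfolding zf_column_def Let_def column_def matrix_matrix_mult_def conj_transpose_def by measurable

lemma borel_measurable_hermitian [measurable (raw)]:
  assumes [measurable]: "f \<in> borel_measurable M" "g \<in> borel_measurable M"
  shows "(\<lambda>x. hermitian (f x) (g x)) \<in> borel_measurable M"
  unfolding hermitian_def by measurable

text \<open>With coefficients bounded by \<open>n\<close> the condition is the projection of a
  closed set along a compact one, hence closed. The set is the countable union over
  \<open>n\<close>.\<close>

lemma sets_in_others_span:
  "{G :: complex ^ 'm :: finite ^ 'k :: finite. G $ k \<in> others_span (($) G) k} \<in> sets borel"
proof -
  define C where "C n = cball 0 (real n) \<inter> {c :: complex ^ 'k. c $ k = 0}" for n
  define T where "T = {(c, G :: complex ^ 'm ^ 'k). combination (($) G) c = G $ k}"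
  have "closed {c :: complex ^ 'k. c $ k = 0}"
    by (rule closed_subspace[OF subspace_coordinate_zero])
  then have C: "compact (C n)" for n unfolding C_def by (simp add: compact_Int_closed)
  have "closed T"
    unfolding T_def case_prod_beta combination_def vector_scalar_mult_def
    by (intro closed_Collect_eq continuous_intros)
  then have "closed {G. \<exists>c. c \<in> C n \<and> (c, G) \<in> T}" for n
    by (rule closed_compact_projection[OF C])
  then have "(\<Union>n. {G. \<exists>c. c \<in> C n \<and> (c, G) \<in> T}) \<in> sets borel" by (intro sets.countable_UN) auto
  also have "(\<Union>n. {G. \<exists>c. c \<in> C n \<and> (c, G) \<in> T}) = {G. G $ k \<in> others_span (($) G) k}"
  proof (intro set_eqI iffI)
    fix G :: "complex ^ 'm ^ 'k" assume "G \<in> {G. G $ k \<in> others_span (($) G) k}"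
    then obtain c where c: "c $ k = 0" "G $ k = combination (($) G) c" by (auto simp: others_span_def)
    obtain n where "norm c \<le> real n" using real_arch_simple by blast
    with c show "G \<in> (\<Union>n. {G. \<exists>c. c \<in> C n \<and> (c, G) \<in> T})"
      by (auto simp: C_def T_def intro!: exI[of _ n] exI[of _ c])
  qed (auto simp: C_def T_def others_span_def intro!: image_eqI)
  finally show ?thesis .
qed

lemma pred_in_others_span [measurable (raw)]:
  fixes g :: "'a \<Rightarrow> 'k :: finite \<Rightarrow> complex ^ 'm :: finite"
  assumes [measurable]: "\<And>j. (\<lambda>x. g x j) \<in> borel_measurable M"
  shows "Measurable.pred M (\<lambda>x. g x k \<in> others_span (g x) k)"
proof -
  have "(\<lambda>x. \<chi> j. g x j) \<in> borel_measurable M" by measurable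
  from measurable_sets[OF this sets_in_others_span[of k]] show ?thesis
    by (simp add: pred_def vimage_def Int_def conj_commute vec_lambda_inverse)
qed

text \<open>Fubini for null sets, obtained by integrating the indicator of the failure of
  \<open>P\<close>.\<close>

lemma (in product_sigma_finite) AE_PiM_insert_iff:
  assumes I: "finite I" "i \<notin> I" and [measurable]: "Measurable.pred (PiM (insert i I) M) P"
  shows "(AE x in PiM (insert i I) M. P x) \<longleftrightarrow> (AE x in PiM I M. AE y in M i. P (x(i := y)))"
proof -
  interpret sigma_finite_measure "M i" by (rule sigma_finite_measures)
  let ?f = "\<lambda>x. if P x then 0 else (1 :: ennreal)"
  have [measurable]: "(\<lambda>(x, y). ?f (x(i := y))) \<in> borel_measurable (PiM I M \<Otimes>\<^sub>M M i)"
    by measurable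
  have "(AE x in PiM (insert i I) M. P x) \<longleftrightarrow> (\<integral>\<^sup>+x. ?f x \<partial>PiM (insert i I) M) = 0"
    by (subst nn_integral_0_iff_AE) (auto split: if_splits)
  also have "\<dots> \<longleftrightarrow> (\<integral>\<^sup>+x. \<integral>\<^sup>+y. ?f (x(i := y)) \<partial>M i \<partial>PiM I M) = 0"
    using I by (subst product_nn_integral_insert) auto
  also have "\<dots> \<longleftrightarrow> (AE x in PiM I M. (\<integral>\<^sup>+y. ?f (x(i := y)) \<partial>M i) = 0)"
    by (rule nn_integral_0_iff_AE) measurable
  also have "\<dots> \<longleftrightarrow> (AE x in PiM I M. AE y in M i. P (x(i := y)))"
  proof (rule AE_cong)
    fix x assume [measurable]: "x \<in> space (PiM I M)"
    have "(\<lambda>y. ?f (x(i := y))) \<in> borel_measurable (M i)"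
      using I by measurable
    then show "(\<integral>\<^sup>+y. ?f (x(i := y)) \<partial>M i) = 0 \<longleftrightarrow> (AE y in M i. P (x(i := y)))"
      by (subst nn_integral_0_iff_AE) (auto split: if_splits)
  qed
  finally show ?thesis .
qed

lemma product_sigma_finite_complex_gaussian:
  "(\<And>j. s j > 0) \<Longrightarrow> product_sigma_finite (\<lambda>j. complex_gaussian (s j))"
  by (intro product_sigma_finite.intro prob_space_imp_sigma_finite prob_space_complex_gaussian)
    (simp add: less_imp_le)

text \<open>Here \<open>y j\<close> plays the observation for pilot \<open>j\<close> at one base
  station, with variance \<open>s j\<close>, and \<open>\<kappa> j\<close> the MMSE factor that
  turns it into an estimate.\<close>

context
  fixes s \<kappa> :: "'k :: finite \<Rightarrow> real" and N :: "'k \<Rightarrow> (complex ^ 'm :: finite) measure"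
    and est :: "('k \<Rightarrow> complex ^ 'm) \<Rightarrow> 'k \<Rightarrow> complex ^ 'm"
  assumes s: "\<And>j. s j > 0" and \<kappa>: "\<And>j. \<kappa> j > 0" and less: "CARD('k) < CARD('m)"
  defines "N \<equiv> \<lambda>j. complex_gaussian (s j)"
  defines "est \<equiv> \<lambda>y j. \<kappa> j *\<^sub>R y j"
begin

interpretation product_sigma_finite N
  unfolding N_def by (rule product_sigma_finite_complex_gaussian[OF s])

lemma sets_N [simp, measurable_cong]: "sets (N j) = sets borel"
  by (simp add: N_def)

lemma insert_compl: "insert k (UNIV - {k}) = UNIV" by auto

lemma est_upd: "est (y(k := x)) = (est y)(k := \<kappa> k *\<^sub>R x)"
  by (auto simp: est_def)

lemma measurable_est [measurable]: "(\<lambda>y. est y j) \<in> borel_measurable (PiM UNIV N)"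
  unfolding est_def by measurable

text \<open>With the other observations fixed, the span of their estimates has real dimension at
  most \<open>2 * (CARD('k) - 1)\<close>, less than \<open>2 * CARD('m)\<close>, so the remaining
  Gaussian column misses it almost surely.\<close>

lemma AE_not_in_others_span_est:
  "AE y in PiM UNIV N. \<forall>k\<in>UNIV. est y k \<notin> others_span (est y) k"
proof -
  have "AE y in PiM (insert k (UNIV - {k})) N. est y k \<notin> others_span (est y) k" for k
  proof (subst AE_PiM_insert_iff)
    show "Measurable.pred (PiM (insert k (UNIV - {k})) N) (\<lambda>y. est y k \<notin> others_span (est y) k)"
      unfolding insert_compl by measurable
    have "AE x in N k. x \<notin> others_span (est y) k" for y
    proof -
      have "CARD('k) > 0" by simp
      then have "2 * (CARD('k) - 1) < 2 * CARD('m)" using less by linarith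
      then show ?thesis
        unfolding N_def using le_less_trans[OF dim_others_span_le]
        by (intro AE_complex_gaussian_subspace s subspace_others_span) blast
    qed
    moreover have "x \<in> others_span (est y) k" if "\<kappa> k *\<^sub>R x \<in> others_span (est y) k" for x y
      using subspace_scale[OF subspace_others_span that, of "inverse (\<kappa> k)"] \<kappa>[of k] by simp
    ultimately have "AE x in N k. est (y(k := x)) k \<notin> others_span (est (y(k := x))) k" for y
      unfolding est_upd by (simp add: others_span_upd) (metis (mono_tags, lifting) eventually_mono)
    then show "AE y in PiM (UNIV - {k}) N. AE x in N k.
        est (y(k := x)) k \<notin> others_span (est (y(k := x))) k"
      by simp
  qed auto
  then show ?thesis
    unfolding insert_compl by (intro AE_ball_countable[THEN iffD2]) auto
qed

lemma AE_inj_combination_est: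
  "AE y in PiM (UNIV - {k}) N. AE x in N k. inj (combination (est (y(k := x))))"
proof -
  have "Measurable.pred (PiM UNIV N) (\<lambda>y. \<forall>k\<in>UNIV. est y k \<notin> others_span (est y) k)"
    by measurable
  then have "AE y in PiM (UNIV - {k}) N. AE x in N k.
      \<forall>j\<in>UNIV. est (y(k := x)) j \<notin> others_span (est (y(k := x))) j"
    using AE_PiM_insert_iff[of "UNIV - {k}" k "\<lambda>y. \<forall>k\<in>UNIV. est y k \<notin> others_span (est y) k"]
      AE_not_in_others_span_est unfolding insert_compl by simp
  then show ?thesis
    by (rule eventually_mono) (auto elim!: eventually_mono intro: inj_combination)
qed

text \<open>Column \<open>k\<close> is integrated first. By \<open>norm_zf_column\<close> the
  integrand is the inverse squared length of its projection onto the complement of the others, so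
  the inverse moment applies; \<open>(\<kappa> k)\<^sup>2\<close> comes from the scaling.\<close>

lemma nn_integral_norm_zf_column:
  "(\<integral>\<^sup>+y. ennreal ((norm (zf_column (est y) k))\<^sup>2) \<partial>PiM UNIV N)
    = ennreal (1 / ((real CARD('m) - real CARD('k)) * ((\<kappa> k)\<^sup>2 * s k)))"
proof -
  let ?c = "ennreal (1 / ((real CARD('m) - real CARD('k)) * ((\<kappa> k)\<^sup>2 * s k)))"
  interpret O: prob_space "PiM (UNIV - {k}) N"
    by (intro prob_space_PiM) (simp add: N_def prob_space_complex_gaussian less_imp_le[OF s])
  interpret prob_space "N k"
    by (simp add: N_def prob_space_complex_gaussian less_imp_le[OF s])
  have meas: "(\<lambda>y. ennreal ((norm (zf_column (est y) k))\<^sup>2)) \<in> borel_measurable (PiM UNIV N)"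
    by measurable
  have "(\<integral>\<^sup>+y. ennreal ((norm (zf_column (est y) k))\<^sup>2) \<partial>PiM UNIV N)
      = (\<integral>\<^sup>+y. \<integral>\<^sup>+x. ennreal ((norm (zf_column (est (y(k := x))) k))\<^sup>2) \<partial>N k \<partial>PiM (UNIV - {k}) N)"
    using product_nn_integral_insert[of "UNIV - {k}" k, unfolded insert_compl, OF _ _ meas] by simp
  also have "\<dots> = (\<integral>\<^sup>+y. ?c \<partial>PiM (UNIV - {k}) N)"
  proof (rule nn_integral_cong_AE, rule AE_mp[OF AE_inj_combination_est[of k]], intro AE_I2 impI)
    fix y assume inj: "AE x in N k. inj (combination (est (y(k := x))))"
    \<comment> \<open>One good \<open>x\<close> is enough, as the span of the other columns does not
      depend on \<open>x\<close>.\<close>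
    have "\<exists>x. inj (combination (est (y(k := x))))"
    proof (rule ccontr)
      assume "\<nexists>x. inj (combination (est (y(k := x))))"
      with inj have "AE x in N k. False" by simp
      then show False by simp
    qed
    then obtain x where "inj (combination (est (y(k := x))))" ..
    then have dim: "dim (others_span (est y) k) = 2 * (CARD('k) - 1)"
      using dim_others_span[of "est (y(k := x))" k] by (simp add: est_upd)
    obtain B where B: "pairwise orthogonal B" "\<And>u. u \<in> B \<Longrightarrow> norm u = 1"
        "span B = {z. \<forall>x\<in>others_span (est y) k. orthogonal x z}"
        and card: "card B + dim (others_span (est y) k) = 2 * CARD('m)"
      by (rule others_span_complement_basis[of "est y" k]) blast
    \<comment> \<open>The inverse moment is used with \<open>r = CARD('m) - CARD('k)\<close>, where
      \<open>r \<ge> 1\<close> is the assumption of more antennas than users.\<close>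
    have cB: "card B = 2 * ((CARD('m) - CARD('k)) + 1)"
      using card[unfolded dim] less zero_less_card_finite[where 'a='k] by arith
    have "(\<integral>\<^sup>+x. ennreal ((norm (zf_column (est (y(k := x))) k))\<^sup>2) \<partial>N k)
        = (\<integral>\<^sup>+x. ennreal (1 / (\<kappa> k)\<^sup>2) * inverse (ennreal (\<Sum>u\<in>B. (x \<bullet> u)\<^sup>2)) \<partial>N k)"
    proof (rule nn_integral_cong_AE, rule AE_mp[OF inj], intro AE_I2 impI)
      fix x assume "inj (combination (est (y(k := x))))"
      then have "ennreal ((norm (zf_column (est (y(k := x))) k))\<^sup>2)
          = inverse (ennreal (\<Sum>u\<in>B. (est (y(k := x)) k \<bullet> u)\<^sup>2))"
        by (rule norm_zf_column) (simp_all add: B est_upd)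
      also have "(\<Sum>u\<in>B. (est (y(k := x)) k \<bullet> u)\<^sup>2) = (\<kappa> k)\<^sup>2 * (\<Sum>u\<in>B. (x \<bullet> u)\<^sup>2)"
        by (simp add: est_upd power_mult_distrib sum_distrib_left)
      also have "inverse (ennreal \<dots>) = ennreal (1 / (\<kappa> k)\<^sup>2) * inverse (ennreal (\<Sum>u\<in>B. (x \<bullet> u)\<^sup>2))"
        using \<kappa>[of k] by (simp add: ennreal_mult sum_nonneg ennreal_inverse_mult inverse_ennreal inverse_eq_divide)
      finally show "ennreal ((norm (zf_column (est (y(k := x))) k))\<^sup>2) = \<dots>" .
    qed
    also have "\<dots> = ennreal (1 / (\<kappa> k)\<^sup>2) * (\<integral>\<^sup>+x. inverse (ennreal (\<Sum>u\<in>B. (x \<bullet> u)\<^sup>2)) \<partial>N k)"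
      by (rule nn_integral_cmult) (unfold N_def, measurable)
    also have "\<dots> = ennreal (1 / (\<kappa> k)\<^sup>2) * ennreal (1 / (s k * real (CARD('m) - CARD('k))))"
      using less unfolding N_def
      by (subst nn_integral_complex_gaussian_inverse_norm_sq[OF s B(1,2) cB]) auto
    also have "\<dots> = ?c"
      using less s[of k] \<kappa>[of k] by (simp add: ennreal_mult[symmetric] of_nat_diff mult_ac)
    finally show "(\<integral>\<^sup>+x. ennreal ((norm (zf_column (est (y(k := x))) k))\<^sup>2) \<partial>N k) = ?c" .
  qed
  also have "\<dots> = ?c" by (simp add: O.emeasure_space_1)
  finally show ?thesis .
qed

text \<open>\<open>g\<close> is the channel of interest, \<open>c\<close> its weight in the
  observation for pilot \<open>k\<close>, and \<open>w\<close> the rest of that observation. In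
  terms of the observation \<open>x\<close> and the error \<open>e\<close>, the column depends on
  \<open>x\<close> and \<open>y\<close> only, so the second moment of an affine form in
  \<open>e\<close> applies. The value \<open>c = 0\<close> covers channels absent from the
  observation.\<close>

lemma nn_integral_hermitian_zf_column:
  assumes a: "a \<ge> 0" and t: "t > 0" and sk: "s k = c\<^sup>2 * a + t"
  shows "(\<integral>\<^sup>+y. \<integral>\<^sup>+g. \<integral>\<^sup>+w. ennreal ((cmod (hermitian g (zf_column (est (y(k := c *\<^sub>R g + w))) k')))\<^sup>2)
      \<partial>complex_gaussian t \<partial>complex_gaussian a \<partial>PiM (UNIV - {k}) N)
    = ennreal ((if k' = k then (c * a / (\<kappa> k * s k))\<^sup>2 else 0)
        + a * t / s k * (1 / ((real CARD('m) - real CARD('k)) * ((\<kappa> k')\<^sup>2 * s k'))))"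
proof -
  \<comment> \<open>\<open>?d\<close> is the MMSE coefficient of \<open>g\<close> given the
    observation, \<open>?w\<close> the error variance, and \<open>?e\<close> the squared modulus
    that \<open>?d *\<^sub>R x\<close> contributes.\<close>
  let ?z = "\<lambda>y x. zf_column (est (y(k := x))) k'" and ?d = "c * a / s k" and ?w = "a * t / s k"
  let ?e = "if k' = k then (c * a / (\<kappa> k * s k))\<^sup>2 else 0"
  interpret prob_space "PiM UNIV N"
    by (intro prob_space_PiM) (simp add: N_def prob_space_complex_gaussian less_imp_le[OF s])
  have w: "?w \<ge> 0" using a t s[of k] by simp
  have e: "?e \<ge> 0" by simp
  have r: "1 / ((real CARD('m) - real CARD('k)) * ((\<kappa> k')\<^sup>2 * s k')) \<ge> 0"
    using less s[of k'] by simp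
  have m1[measurable]: "(\<lambda>x. ?z y x) \<in> borel_measurable borel" for y
    by (rule borel_measurable_zf_column) (simp add: est_def fun_upd_def)
  have m2: "(\<lambda>y. ennreal (?e + ?w * (norm (zf_column (est y) k'))\<^sup>2)) \<in> borel_measurable (PiM UNIV N)"
    by measurable
  have "(\<integral>\<^sup>+y. \<integral>\<^sup>+g. \<integral>\<^sup>+x. ennreal ((cmod (hermitian g (?z y (c *\<^sub>R g + x))))\<^sup>2)
      \<partial>complex_gaussian t \<partial>complex_gaussian a \<partial>PiM (UNIV - {k}) N)
    = (\<integral>\<^sup>+y. \<integral>\<^sup>+x. \<integral>\<^sup>+e. ennreal ((cmod (hermitian (e + ?d *\<^sub>R x) (?z y x)))\<^sup>2)
      \<partial>complex_gaussian ?w \<partial>N k \<partial>PiM (UNIV - {k}) N)"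
  proof (rule nn_integral_cong)
    fix y assume [measurable]: "y \<in> space (PiM (UNIV - {k}) N)"
    show "(\<integral>\<^sup>+g. \<integral>\<^sup>+x. ennreal ((cmod (hermitian g (?z y (c *\<^sub>R g + x))))\<^sup>2)
      \<partial>complex_gaussian t \<partial>complex_gaussian a)
    = (\<integral>\<^sup>+x. \<integral>\<^sup>+e. ennreal ((cmod (hermitian (e + ?d *\<^sub>R x) (?z y x)))\<^sup>2)
      \<partial>complex_gaussian ?w \<partial>N k)"
      unfolding N_def sk
      by (rule nn_integral_complex_gaussian_linear_observation[OF a t]) measurable
  qed
  also have "\<dots> = (\<integral>\<^sup>+y. \<integral>\<^sup>+x. ennreal (?e + ?w * (norm (?z y x))\<^sup>2) \<partial>N k \<partial>PiM (UNIV - {k}) N)"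
  proof (rule nn_integral_cong_AE, rule AE_mp[OF AE_inj_combination_est[of k]], intro AE_I2 impI)
    fix y assume inj: "AE x in N k. inj (combination (est (y(k := x))))"
    show "(\<integral>\<^sup>+x. \<integral>\<^sup>+e. ennreal ((cmod (hermitian (e + ?d *\<^sub>R x) (?z y x)))\<^sup>2) \<partial>complex_gaussian ?w \<partial>N k)
      = (\<integral>\<^sup>+x. ennreal (?e + ?w * (norm (?z y x))\<^sup>2) \<partial>N k)"
    proof (rule nn_integral_cong_AE, rule AE_mp[OF inj], intro AE_I2 impI)
      fix x assume "inj (combination (est (y(k := x))))"
      \<comment> \<open>Zero-forcing fixes the inner product with the estimate
        \<open>\<kappa> k *\<^sub>R x\<close>, hence also that with \<open>x\<close>.\<close>
      from hermitian_zf_column[OF this, of k k']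
      have "complex_of_real (\<kappa> k) * hermitian x (?z y x) = (if k' = k then 1 else 0)"
        by (simp add: est_upd hermitian_def scaleR_conv_of_real[where 'a = complex] sum_distrib_left mult_ac eq_commute)
      then have h: "hermitian x (?z y x) = (if k' = k then 1 / complex_of_real (\<kappa> k) else 0)"
        using \<kappa>[of k] by (auto simp: field_simps split: if_splits)
      have "hermitian (e + ?d *\<^sub>R x) (?z y x)
          = (if k' = k then of_real (c * a / (\<kappa> k * s k)) else 0) + (\<Sum>i\<in>UNIV. cnj (e $ i) * ?z y x $ i)" for e
      proof -
        have "hermitian (?d *\<^sub>R x) (?z y x) = of_real ?d * hermitian x (?z y x)"
          by (simp add: hermitian_def scaleR_conv_of_real[where 'a = complex] sum_distrib_left mult_ac)
        then show ?thesis
          by (simp add: hermitian_add_left h mult.commute) (simp add: hermitian_def)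
      qed
      then show "(\<integral>\<^sup>+e. ennreal ((cmod (hermitian (e + ?d *\<^sub>R x) (?z y x)))\<^sup>2) \<partial>complex_gaussian ?w)
          = ennreal (?e + ?w * (norm (?z y x))\<^sup>2)"
        using nn_integral_complex_gaussian_cmod_sq[OF w, of "if k' = k then of_real (c * a / (\<kappa> k * s k)) else 0" "?z y x"]
        by (simp add: norm_divide norm_mult power_divide power_mult_distrib del: of_real_divide of_real_mult split: if_splits)
    qed
  qed
  also have "\<dots> = (\<integral>\<^sup>+y. ennreal (?e + ?w * (norm (zf_column (est y) k'))\<^sup>2) \<partial>PiM UNIV N)"
    using product_nn_integral_insert[of "UNIV - {k}" k, unfolded insert_compl, OF _ _ m2] by simp
  also have "\<dots> = (\<integral>\<^sup>+y. ennreal ?e + ennreal ?w * ennreal ((norm (zf_column (est y) k'))\<^sup>2) \<partial>PiM UNIV N)"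
    by (simp only: ennreal_plus[OF e mult_nonneg_nonneg[OF w zero_le_power2]]
        ennreal_mult[OF w zero_le_power2])
  also have "\<dots> = ennreal ?e + ennreal ?w * (\<integral>\<^sup>+y. ennreal ((norm (zf_column (est y) k'))\<^sup>2) \<partial>PiM UNIV N)"
    by (subst nn_integral_add) (auto simp: nn_integral_cmult emeasure_space_1)
  also have "\<dots> = ennreal (?e + ?w * (1 / ((real CARD('m) - real CARD('k)) * ((\<kappa> k')\<^sup>2 * s k'))))"
    unfolding nn_integral_norm_zf_column
    by (simp only: ennreal_plus[OF e mult_nonneg_nonneg[OF w r]] ennreal_mult[OF w r])
  finally show ?thesis .
qed

end

subsection \<open>Independence of channels and observations\<close>

text \<open>\<open>X\<close> and \<open>Y\<close> will be restrictions of the family of all channels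
  and noises to disjoint index sets, with \<open>f\<close> and \<open>g\<close> extracting the
  relevant quantities.\<close>

lemma (in prob_space) nn_integral_indep_compose:
  assumes XY: "indep_var N1 X N2 Y"
    and [measurable]: "f \<in> measurable N1 L1" "g \<in> measurable N2 L2"
    and F[measurable]: "(\<lambda>(x, y). F x y) \<in> borel_measurable (L1 \<Otimes>\<^sub>M L2)"
  shows "(\<integral>\<^sup>+\<omega>. F (f (X \<omega>)) (g (Y \<omega>)) \<partial>M)
    = (\<integral>\<^sup>+y. \<integral>\<^sup>+x. F x y \<partial>distr M L1 (\<lambda>\<omega>. f (X \<omega>)) \<partial>distr M L2 (\<lambda>\<omega>. g (Y \<omega>)))"
proof -
  have [measurable]: "X \<in> measurable M N1" "Y \<in> measurable M N2"
    using XY by (auto simp: indep_var_distribution_eq)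
  interpret X: prob_space "distr M N1 X" by (rule prob_space_distr) measurable
  interpret Y: prob_space "distr M N2 Y" by (rule prob_space_distr) measurable
  interpret XY: pair_prob_space "distr M N1 X" "distr M N2 Y" ..
  interpret X': prob_space "distr M L1 (\<lambda>\<omega>. f (X \<omega>))" by (rule prob_space_distr) measurable
  have eq: "distr M L1 (\<lambda>\<omega>. f (X \<omega>)) = distr (distr M N1 X) L1 f"
    "distr M L2 (\<lambda>\<omega>. g (Y \<omega>)) = distr (distr M N2 Y) L2 g"
    by (simp_all add: distr_distr comp_def)
  have [measurable]: "(\<lambda>y. \<integral>\<^sup>+x. F x y \<partial>distr M L1 (\<lambda>\<omega>. f (X \<omega>))) \<in> borel_measurable L2"
    by (rule X'.borel_measurable_nn_integral) (auto intro: measurable_compose[OF measurable_pair_swap' F, simplified] simp: split_beta')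
  have "(\<integral>\<^sup>+\<omega>. F (f (X \<omega>)) (g (Y \<omega>)) \<partial>M)
      = (\<integral>\<^sup>+(x, y). F (f x) (g y) \<partial>distr M (N1 \<Otimes>\<^sub>M N2) (\<lambda>\<omega>. (X \<omega>, Y \<omega>)))"
    by (subst nn_integral_distr) (auto simp: split_beta)
  also have "\<dots> = (\<integral>\<^sup>+(x, y). F (f x) (g y) \<partial>(distr M N1 X \<Otimes>\<^sub>M distr M N2 Y))"
    using XY by (simp add: indep_var_distribution_eq)
  also have "\<dots> = (\<integral>\<^sup>+y. \<integral>\<^sup>+x. F (f x) (g y) \<partial>distr M N1 X \<partial>distr M N2 Y)"
    by (subst XY.nn_integral_snd[symmetric]) (auto simp: split_beta)
  also have "\<dots> = (\<integral>\<^sup>+y. \<integral>\<^sup>+x. F x (g y) \<partial>distr M L1 (\<lambda>\<omega>. f (X \<omega>)) \<partial>distr M N2 Y)"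
  proof (rule nn_integral_cong)
    fix y assume "y \<in> space (distr M N2 Y)"
    then have [measurable]: "g y \<in> space L2" using measurable_space[OF assms(3)] by simp
    show "(\<integral>\<^sup>+x. F (f x) (g y) \<partial>distr M N1 X) = (\<integral>\<^sup>+x. F x (g y) \<partial>distr M L1 (\<lambda>\<omega>. f (X \<omega>)))"
      unfolding eq(1) by (subst nn_integral_distr) auto
  qed
  also have "\<dots> = (\<integral>\<^sup>+y. \<integral>\<^sup>+x. F x y \<partial>distr M L1 (\<lambda>\<omega>. f (X \<omega>)) \<partial>distr M L2 (\<lambda>\<omega>. g (Y \<omega>)))"
    unfolding eq(2) by (subst nn_integral_distr) auto
  finally show ?thesis .
qed

lemma zf_direction_eq: "zf_direction S b k \<omega> = zf_column (\<lambda>j. mmse_estimate S b j \<omega>) k"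
  by (simp add: zf_direction_def zf_column_def estimate_matrix_def)

context rayleigh_mimo
begin

abbreviation "M \<equiv> pspace S"

interpretation prob_space M by (rule prob_space_pspace)

definition rv :: "('l \<times> 'l \<times> 'k) + ('l \<times> 'k) \<Rightarrow> 'w \<Rightarrow> complex ^ 'm" where
  "rv = case_sum (\<lambda>(b, l, k). channel S b l k) (\<lambda>(l, k). noise S l k)"

lemma rv_simps [simp]: "rv (Inl (b, l, k)) = channel S b l k" "rv (Inr (l, k)) = noise S l k"
  by (simp_all add: rv_def)

lemma indep_rv: "indep_vars (\<lambda>_. borel) rv UNIV"
  using independent by (simp add: rv_def)

lemma measurable_channel [measurable]: "channel S b l k \<in> borel_measurable M"
  using indep_rv unfolding indep_vars_def by (metis UNIV_I rv_simps(1))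

lemma measurable_noise [measurable]: "noise S l k \<in> borel_measurable M"
  using indep_rv unfolding indep_vars_def by (metis UNIV_I rv_simps(2))

definition pilot_gain :: "'l \<Rightarrow> 'k \<Rightarrow> real" where
  "pilot_gain l k = real (pilot_len S) * sqrt (pilot_power S l k)"

text \<open>
  As a function of all channels and noises, the observation depends only on the variables in
  \<open>obs_index\<close>, so that independence reduces to disjointness of index sets. Removing a cell from
  \<open>A\<close> gives the part of the observation that is independent of the channels of that cell.
\<close>

definition partial_obs ::
    "'l set \<Rightarrow> 'l \<Rightarrow> 'k \<Rightarrow> (('l \<times> 'l \<times> 'k) + ('l \<times> 'k) \<Rightarrow> complex ^ 'm) \<Rightarrow> complex ^ 'm" where
  "partial_obs A b k x = (\<Sum>l\<in>A. pilot_gain l k *\<^sub>R x (Inl (b, l, k))) + x (Inr (b, k))"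

definition obs_index :: "'l set \<Rightarrow> 'l \<Rightarrow> 'k \<Rightarrow> (('l \<times> 'l \<times> 'k) + ('l \<times> 'k)) set" where
  "obs_index A b k = insert (Inr (b, k)) ((\<lambda>l. Inl (b, l, k)) ` A)"

abbreviation obs :: "'l set \<Rightarrow> 'l \<Rightarrow> 'k \<Rightarrow> 'w \<Rightarrow> complex ^ 'm" where
  "obs A b k \<omega> \<equiv> partial_obs A b k (\<lambda>i. rv i \<omega>)"

definition obs_var :: "'l set \<Rightarrow> 'l \<Rightarrow> 'k \<Rightarrow> real" where
  "obs_var A b k = (\<Sum>l\<in>A. (pilot_gain l k)\<^sup>2 * fading S b l k) + real (pilot_len S) * ul_noise_var S"

lemma observation_eq: "observation S b k = obs (group S b) b k"
  by (simp add: fun_eq_iff observation_def partial_obs_def pilot_gain_def)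

lemma measurable_partial_obs:
  assumes "obs_index A b k \<subseteq> I"
  shows "partial_obs A b k \<in> borel_measurable (PiM I (\<lambda>_. borel))"
  unfolding partial_obs_def
  using assms by (intro borel_measurable_add borel_measurable_sum borel_measurable_scaleR
      borel_measurable_const measurable_component_singleton) (auto simp: obs_index_def)

lemma measurable_obs [measurable]: "obs A b k \<in> borel_measurable M"
  unfolding partial_obs_def by simp

lemma partial_obs_restrict:
  assumes "obs_index A b k \<subseteq> I"
  shows "partial_obs A b k (restrict x I) = partial_obs A b k x"
  using assms by (auto simp: partial_obs_def obs_index_def intro!: sum.cong)

lemma obs_var_pos: "obs_var A b k > 0"
  unfolding obs_var_def
  by (intro add_nonneg_pos sum_nonneg mult_nonneg_nonneg fading_nonneg mult_pos_pos ul_noise_var_pos)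
    (use pilot_len_pos in auto)

lemma indep_channel_obs:
  assumes "l \<notin> A"
  shows "indep_var borel (channel S b l k) borel (obs A b k)"
proof -
  have "indep_var borel (\<lambda>\<omega>. (restrict (\<lambda>i. rv i \<omega>) {Inl (b, l, k)}) (Inl (b, l, k)))
      borel (\<lambda>\<omega>. partial_obs A b k (restrict (\<lambda>i. rv i \<omega>) (obs_index A b k)))"
    using assms indep_var_compose[OF indep_var_restrict[OF indep_rv, of "{Inl (b, l, k)}" "obs_index A b k"]
        measurable_component_singleton measurable_partial_obs[OF order_refl]]
    by (auto simp: obs_index_def comp_def)
  then show ?thesis by (simp add: partial_obs_restrict)
qed

text \<open>Induction on \<open>A\<close>. A new channel is independent of the rest of the
  observation, so the linear observation lemma gives the law of the sum: its integrand here ignores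
  the channel, and the error integrates to \<open>1\<close>.\<close>

lemma distr_obs: "distr M borel (obs A b k) = complex_gaussian (obs_var A b k)"
proof (induction A rule: finite_induct[OF finite])
  case 1
  then show ?case using noise_distr[of b k] by (simp add: partial_obs_def obs_var_def)
next
  case (2 l A)
  let ?g = "channel S b l k" and ?c = "pilot_gain l k"
  have sum: "obs (insert l A) b k \<omega> = ?c *\<^sub>R ?g \<omega> + obs A b k \<omega>" for \<omega>
    using 2 by (simp add: partial_obs_def add.assoc)
  have var: "obs_var (insert l A) b k = ?c\<^sup>2 * fading S b l k + obs_var A b k"
    using 2 by (simp add: obs_var_def)
  have w: "fading S b l k * obs_var A b k / obs_var (insert l A) b k \<ge> 0"
    using fading_nonneg obs_var_pos by (simp add: less_imp_le)
  have indep: "distr M borel ?g \<Otimes>\<^sub>M distr M borel (obs A b k)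
      = distr M (borel \<Otimes>\<^sub>M borel) (\<lambda>\<omega>. (?g \<omega>, obs A b k \<omega>))"
    using indep_channel_obs[OF 2(2)] by (simp add: indep_var_distribution_eq)
  interpret W: prob_space "complex_gaussian (obs_var A b k) :: (complex ^ 'm) measure"
    by (intro prob_space_complex_gaussian less_imp_le obs_var_pos)
  interpret E: prob_space "complex_gaussian (fading S b l k * obs_var A b k / obs_var (insert l A) b k) :: (complex ^ 'm) measure"
    by (rule prob_space_complex_gaussian[OF w])
  show ?case
  proof (rule measure_eqI)
    fix B assume "B \<in> sets (distr M borel (obs (insert l A) b k))"
    then have [measurable]: "B \<in> sets borel" by simp
    have "(\<lambda>x :: (complex ^ 'm) \<times> (complex ^ 'm). indicator B (?c *\<^sub>R fst x + snd x) :: ennreal)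
        \<in> borel_measurable (borel \<Otimes>\<^sub>M borel)"
      by (rule measurable_compose[OF _ borel_measurable_indicator[of B borel]]) measurable
    then have m: "(\<lambda>(g, w). indicator B (?c *\<^sub>R g + w) :: ennreal) \<in> borel_measurable
        (complex_gaussian (fading S b l k) \<Otimes>\<^sub>M complex_gaussian (obs_var A b k))"
      by (simp add: split_beta' cong: measurable_cong_sets sets_pair_measure_cong)
    have "emeasure (distr M borel (obs (insert l A) b k)) B
        = (\<integral>\<^sup>+\<omega>. indicator B (?c *\<^sub>R ?g \<omega> + obs A b k \<omega>) \<partial>M)"
      by (subst nn_integral_indicator[symmetric], simp, subst nn_integral_distr) (simp_all add: sum)
    also have "\<dots> = (\<integral>\<^sup>+(g, w). indicator B (?c *\<^sub>R g + w)
        \<partial>(complex_gaussian (fading S b l k) \<Otimes>\<^sub>M complex_gaussian (obs_var A b k)))"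
      unfolding channel_distr[symmetric] 2(3)[symmetric] indep
      by (subst nn_integral_distr) (auto simp: split_beta)
    also have "\<dots> = (\<integral>\<^sup>+g. \<integral>\<^sup>+w. indicator B (?c *\<^sub>R g + w)
        \<partial>complex_gaussian (obs_var A b k) \<partial>complex_gaussian (fading S b l k))"
      by (subst W.nn_integral_fst[symmetric]) (simp_all add: m)
    also have "\<dots> = (\<integral>\<^sup>+y. \<integral>\<^sup>+e. indicator B y \<partial>(complex_gaussian
        (fading S b l k * obs_var A b k / obs_var (insert l A) b k) :: (complex ^ 'm) measure) \<partial>complex_gaussian (obs_var (insert l A) b k))"
      unfolding var
      by (rule nn_integral_complex_gaussian_linear_observation[where f = "\<lambda>_. indicator B"])
        (auto simp: fading_nonneg obs_var_pos)
    also have "\<dots> = emeasure (complex_gaussian (obs_var (insert l A) b k)) B"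
      by (simp add: E.emeasure_space_1[simplified])
    finally show "emeasure (distr M borel (obs (insert l A) b k)) B
        = emeasure (complex_gaussian (obs_var (insert l A) b k)) B" .
  qed simp
qed

text \<open>Different pilots at one base station use disjoint sets of channels and noises, so their
  observations are independent.\<close>

lemma distr_observations:
  "distr M (PiM J (\<lambda>_. borel)) (\<lambda>\<omega>. \<lambda>j\<in>J. obs A b j \<omega>)
    = PiM J (\<lambda>j. complex_gaussian (obs_var A b j))"
\<comment> \<open>\<open>UNIV - {k}\<close> is empty when there is one user per cell, while the
  characterisation of independence by product measures needs a nonempty index set.\<close>
proof (cases "J = {}")
  case True
  have "return (count_space {\<lambda>_. undefined}) (\<lambda>_. undefined) = count_space {\<lambda>_ :: 'k. undefined :: complex ^ 'm}"
    by (rule measure_eqI) (auto simp: subset_singleton_iff)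
  then show ?thesis
    using True by (simp add: PiM_empty distr_const restrict_def)
next
  case False
  have "indep_vars (\<lambda>j. PiM (obs_index A b j) (\<lambda>_. borel)) (\<lambda>j \<omega>. restrict (\<lambda>i. rv i \<omega>) (obs_index A b j)) J"
    by (intro indep_vars_restrict[OF indep_rv]) (auto simp: disjoint_family_on_def obs_index_def)
  from indep_vars_compose2[OF this measurable_partial_obs[OF order_refl]]
  have "indep_vars (\<lambda>_. borel) (\<lambda>j. obs A b j) J"
    by (simp add: partial_obs_restrict)
  then show ?thesis
    using indep_vars_iff_distr_eq_PiM[OF False, where M' = "\<lambda>_. borel" and X = "\<lambda>j. obs A b j"]
    by (simp add: distr_obs)
qed

text \<open>Turns an expectation into iterated Gaussian integrals. The variables behind pilot
  \<open>k\<close> are disjoint from those behind the other pilots, and \<open>l \<notin> A\<close>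
  separates the channel from the rest of its observation.\<close>

lemma nn_integral_channel_observations:
  fixes F :: "complex ^ 'm \<Rightarrow> complex ^ 'm \<Rightarrow> ('k \<Rightarrow> complex ^ 'm) \<Rightarrow> ennreal"
  assumes l: "l \<notin> A"
    and F[measurable]: "(\<lambda>((g, w), y). F g w y) \<in> borel_measurable ((borel \<Otimes>\<^sub>M borel) \<Otimes>\<^sub>M PiM (UNIV - {k}) (\<lambda>_. borel))"
  shows "(\<integral>\<^sup>+\<omega>. F (channel S b l k \<omega>) (obs A b k \<omega>) (\<lambda>j\<in>UNIV - {k}. obs B b j \<omega>) \<partial>M)
    = (\<integral>\<^sup>+y. \<integral>\<^sup>+g. \<integral>\<^sup>+w. F g w y \<partial>complex_gaussian (obs_var A b k) \<partial>complex_gaussian (fading S b l k)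
        \<partial>PiM (UNIV - {k}) (\<lambda>j. complex_gaussian (obs_var B b j)))"
proof -
  let ?I = "insert (Inl (b, l, k)) (obs_index A b k)" and ?J = "\<Union>j\<in>UNIV - {k}. obs_index B b j"
  define f where "f x = (x (Inl (b, l, k)), partial_obs A b k x)" for x
  define h where "h x = (\<lambda>j\<in>UNIV - {k}. partial_obs B b j x)" for x
  have f[measurable]: "f \<in> measurable (PiM ?I (\<lambda>_. borel)) (borel \<Otimes>\<^sub>M borel)"
    unfolding f_def by (intro measurable_Pair measurable_partial_obs measurable_component_singleton) auto
  have h[measurable]: "h \<in> measurable (PiM ?J (\<lambda>_. borel)) (PiM (UNIV - {k}) (\<lambda>_. borel))"
    unfolding h_def by (intro measurable_restrict measurable_partial_obs) auto
  have f_eq: "f (restrict (\<lambda>i. rv i \<omega>) ?I) = (channel S b l k \<omega>, obs A b k \<omega>)" for \<omega>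
    unfolding f_def by (subst partial_obs_restrict) auto
  have h_eq: "h (restrict (\<lambda>i. rv i \<omega>) ?J) = (\<lambda>j\<in>UNIV - {k}. obs B b j \<omega>)" for \<omega>
    unfolding h_def by (intro restrict_ext partial_obs_restrict) auto
  have indep: "indep_var (PiM ?I (\<lambda>_. borel)) (\<lambda>\<omega>. restrict (\<lambda>i. rv i \<omega>) ?I)
      (PiM ?J (\<lambda>_. borel)) (\<lambda>\<omega>. restrict (\<lambda>i. rv i \<omega>) ?J)"
    by (rule indep_var_restrict[OF indep_rv]) (auto simp: obs_index_def)
  have pair: "distr M (borel \<Otimes>\<^sub>M borel) (\<lambda>\<omega>. (channel S b l k \<omega>, obs A b k \<omega>))
      = complex_gaussian (fading S b l k) \<Otimes>\<^sub>M complex_gaussian (obs_var A b k)"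
    using indep_channel_obs[OF l] by (simp add: indep_var_distribution_eq channel_distr distr_obs)
  interpret W: prob_space "complex_gaussian (obs_var A b k) :: (complex ^ 'm) measure"
    by (intro prob_space_complex_gaussian less_imp_le obs_var_pos)
  have "(\<integral>\<^sup>+\<omega>. F (channel S b l k \<omega>) (obs A b k \<omega>) (\<lambda>j\<in>UNIV - {k}. obs B b j \<omega>) \<partial>M)
      = (\<integral>\<^sup>+y. \<integral>\<^sup>+(g, w). F g w y \<partial>(complex_gaussian (fading S b l k) \<Otimes>\<^sub>M complex_gaussian (obs_var A b k))
        \<partial>PiM (UNIV - {k}) (\<lambda>j. complex_gaussian (obs_var B b j)))"
    using nn_integral_indep_compose[OF indep f h, of "\<lambda>x y. F (fst x) (snd x) y"] F
    by (simp add: f_eq h_eq pair distr_observations split_beta')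
  also have "\<dots> = (\<integral>\<^sup>+y. \<integral>\<^sup>+g. \<integral>\<^sup>+w. F g w y \<partial>complex_gaussian (obs_var A b k) \<partial>complex_gaussian (fading S b l k)
        \<partial>PiM (UNIV - {k}) (\<lambda>j. complex_gaussian (obs_var B b j)))"
  proof (rule nn_integral_cong)
    fix y :: "'k \<Rightarrow> complex ^ 'm" assume "y \<in> space (PiM (UNIV - {k}) (\<lambda>j. complex_gaussian (obs_var B b j)))"
    then have [measurable]: "y \<in> space (PiM (UNIV - {k}) (\<lambda>_. borel))"
      by (simp add: space_PiM)
    have "(\<lambda>(g, w). F g w y) \<in> borel_measurable (borel \<Otimes>\<^sub>M borel)"
      using measurable_compose[OF measurable_Pair2'[of y "PiM (UNIV - {k}) (\<lambda>_. borel)"] F]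
      by (simp add: split_beta')
    then have m: "(\<lambda>(g, w). F g w y) \<in> borel_measurable
        (complex_gaussian (fading S b l k) \<Otimes>\<^sub>M complex_gaussian (obs_var A b k))"
      by (simp cong: measurable_cong_sets sets_pair_measure_cong)
    show "(\<integral>\<^sup>+(g, w). F g w y \<partial>(complex_gaussian (fading S b l k) \<Otimes>\<^sub>M complex_gaussian (obs_var A b k)))
      = (\<integral>\<^sup>+g. \<integral>\<^sup>+w. F g w y \<partial>complex_gaussian (obs_var A b k) \<partial>complex_gaussian (fading S b l k))"
      by (subst W.nn_integral_fst[symmetric]) (simp_all add: m)
  qed
  finally show ?thesis .
qed

subsection \<open>Mean squared channel gains\<close>

definition est_coeff :: "'l \<Rightarrow> 'k \<Rightarrow> real" where
  "est_coeff b k = sqrt (pilot_power S b k) * fading S b b k /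
    (real (pilot_len S) * (\<Sum>l\<in>group S b. pilot_power S l k * fading S b l k) + ul_noise_var S)"

lemma mmse_estimate_eq: "mmse_estimate S b k \<omega> = est_coeff b k *\<^sub>R obs (group S b) b k \<omega>"
  by (simp add: mmse_estimate_def est_coeff_def observation_eq)

lemma estimate_denominator_pos:
  "real (pilot_len S) * (\<Sum>l\<in>group S b. pilot_power S l k * fading S b l k) + ul_noise_var S > 0"
  by (intro add_nonneg_pos ul_noise_var_pos mult_nonneg_nonneg sum_nonneg fading_nonneg
      less_imp_le[OF pilot_power_pos]) simp

lemma est_coeff_pos: "est_coeff b k > 0"
  unfolding est_coeff_def
  by (intro divide_pos_pos mult_pos_pos estimate_denominator_pos fading_own_pos)
    (simp add: pilot_power_pos)

lemma pilot_gain_sq: "(pilot_gain l k)\<^sup>2 = (real (pilot_len S))\<^sup>2 * pilot_power S l k"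
  by (simp add: pilot_gain_def power_mult_distrib less_imp_le[OF pilot_power_pos])

lemma obs_var_group:
  "obs_var (group S b) b k = real (pilot_len S) *
    (real (pilot_len S) * (\<Sum>l\<in>group S b. pilot_power S l k * fading S b l k) + ul_noise_var S)"
  unfolding obs_var_def pilot_gain_sq
  by (simp add: sum_distrib_left algebra_simps power2_eq_square)

lemma group_eq: "l' \<in> group S l \<Longrightarrow> group S l' = group S l"
  using partition_onD2[OF partition_group] own_group[of l'] unfolding disjoint_def by blast

lemma mem_group_iff: "l' \<in> group S l \<longleftrightarrow> l \<in> group S l'"
  using group_eq own_group by metis

text \<open>This form is the squared per-antenna covariance of channel and observation over the
  variance of the observation. The groups of \<open>l\<close> and \<open>b\<close> coincide
  here.\<close>

lemma gamma_eq:
  assumes "l \<in> group S b"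
  shows "gamma S b l k = (pilot_gain l k * fading S b l k)\<^sup>2 / obs_var (group S b) b k"
  unfolding power_mult_distrib pilot_gain_sq obs_var_group gamma_def group_eq[OF assms]
  using pilot_len_pos by (simp add: power2_eq_square)

lemma gamma_own_eq: "gamma S b b k = (est_coeff b k)\<^sup>2 * obs_var (group S b) b k"
  using estimate_denominator_pos[where b = b and k = k]
  by (simp add: gamma_def est_coeff_def obs_var_group power_mult_distrib power_divide
      less_imp_le[OF pilot_power_pos] power2_eq_square)

lemma gamma_own_pos: "gamma S b b k > 0"
  unfolding gamma_own_eq using est_coeff_pos[of b k] obs_var_pos[of "group S b" b k] by simp

context
  assumes less: "CARD('k) < CARD('m)"
begin

lemma integral_norm_zf_direction:
  "(\<integral>\<omega>. (norm (zf_direction S b k \<omega>))\<^sup>2 \<partial>M)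
    = 1 / ((real CARD('m) - real CARD('k)) * gamma S b b k)" (is "?L = ?R")
proof -
  let ?e = "\<lambda>(y :: 'k \<Rightarrow> complex ^ 'm) j. est_coeff b j *\<^sub>R y j"
  have [measurable]: "(\<lambda>\<omega>. zf_direction S b k \<omega>) \<in> borel_measurable M"
    unfolding zf_direction_eq mmse_estimate_eq by measurable
  have d: "distr M (PiM UNIV (\<lambda>_. borel)) (\<lambda>\<omega> j. obs (group S b) b j \<omega>)
      = PiM UNIV (\<lambda>j. complex_gaussian (obs_var (group S b) b j))"
    using distr_observations[of UNIV "group S b" b] by (simp add: restrict_def)
  have "(\<integral>\<^sup>+\<omega>. ennreal ((norm (zf_direction S b k \<omega>))\<^sup>2) \<partial>M)
      = (\<integral>\<^sup>+y. ennreal ((norm (zf_column (?e y) k))\<^sup>2) \<partial>PiM UNIV (\<lambda>j. complex_gaussian (obs_var (group S b) b j)))"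
    unfolding d[symmetric] zf_direction_eq mmse_estimate_eq
    by (subst nn_integral_distr) (auto intro!: measurable_PiM_single')
  also have "\<dots> = ennreal ?R"
    unfolding gamma_own_eq by (rule nn_integral_norm_zf_column) (auto simp: obs_var_pos est_coeff_pos less)
  finally have "(\<integral>\<^sup>+\<omega>. ennreal ((norm (zf_direction S b k \<omega>))\<^sup>2) \<partial>M) = ennreal ?R" .
  then show ?thesis
    using less gamma_own_pos[of b k] by (subst integral_eq_nn_integral) simp_all
qed

lemma nn_integral_hermitian_zf_direction:
  fixes b l :: 'l and k k' :: 'k
  defines "G \<equiv> if l \<in> group S b then gamma S b l k else 0"
  shows "(\<integral>\<^sup>+\<omega>. ennreal ((cmod (hermitian (channel S b l k \<omega>) (zf_direction S b k' \<omega>)))\<^sup>2) \<partial>M)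
    = ennreal ((fading S b l k - G + (if k' = k then (real CARD('m) - real CARD('k)) * G else 0))
        / ((real CARD('m) - real CARD('k)) * gamma S b b k'))"
proof -
  let ?e = "\<lambda>(y :: 'k \<Rightarrow> complex ^ 'm) j. est_coeff b j *\<^sub>R y j" and ?A = "group S b - {l}" and ?a = "fading S b l k"
  let ?s = "obs_var (group S b) b" and ?t = "obs_var ?A b k"
  \<comment> \<open>Outside the pilot group the channel does not enter the observation, and all of
    its variance counts as error.\<close>
  define c where "c = (if l \<in> group S b then pilot_gain l k else 0)"
  have s: "?s k = c\<^sup>2 * ?a + ?t"
    by (simp add: obs_var_def c_def sum.remove[of _ l])
  have sp: "?s k > 0" by (rule obs_var_pos)
  have G: "G = (c * ?a)\<^sup>2 / ?s k"
    by (simp add: G_def c_def gamma_eq)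
  have obs: "obs (group S b) b k \<omega> = c *\<^sub>R channel S b l k \<omega> + obs ?A b k \<omega>" for \<omega>
    by (simp add: partial_obs_def c_def sum.remove[of _ l] add.assoc)
  let ?F = "\<lambda>g w y. ennreal ((cmod (hermitian g (zf_column (?e (y(k := c *\<^sub>R g + w))) k')))\<^sup>2)"
  \<comment> \<open>Filling in entry \<open>k\<close> restores all observations, so the integrand is
    a function of the channel, the rest of its observation and the other observations.\<close>
  have upd: "(\<lambda>j\<in>UNIV - {k}. obs (group S b) b j \<omega>)(k := c *\<^sub>R channel S b l k \<omega> + obs ?A b k \<omega>)
      = (\<lambda>j. obs (group S b) b j \<omega>)" for \<omega>
    by (auto simp: fun_eq_iff obs)
  have F: "(\<lambda>((g, w), y). ?F g w y) \<in> borel_measurable ((borel \<Otimes>\<^sub>M borel) \<Otimes>\<^sub>M PiM (UNIV - {k}) (\<lambda>_. borel))"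
  proof -
    have "(\<lambda>x. ((snd x)(k := c *\<^sub>R fst (fst x) + snd (fst x))) j) \<in> borel_measurable
        ((borel \<Otimes>\<^sub>M borel) \<Otimes>\<^sub>M PiM (UNIV - {k}) (\<lambda>_. borel :: (complex ^ 'm) measure))" for j
      by (cases "j = k") simp_all
    then have [measurable]: "(\<lambda>x. zf_column (?e ((snd x)(k := c *\<^sub>R fst (fst x) + snd (fst x)))) k') \<in> borel_measurable
        ((borel \<Otimes>\<^sub>M borel) \<Otimes>\<^sub>M PiM (UNIV - {k}) (\<lambda>_. borel :: (complex ^ 'm) measure))"
      by (intro borel_measurable_zf_column borel_measurable_scaleR borel_measurable_const)
    show ?thesis unfolding split_beta' by measurable
  qed
  have "(\<integral>\<^sup>+\<omega>. ennreal ((cmod (hermitian (channel S b l k \<omega>) (zf_direction S b k' \<omega>)))\<^sup>2) \<partial>M)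
      = (\<integral>\<^sup>+\<omega>. ?F (channel S b l k \<omega>) (obs ?A b k \<omega>) (\<lambda>j\<in>UNIV - {k}. obs (group S b) b j \<omega>) \<partial>M)"
    unfolding upd zf_direction_eq mmse_estimate_eq ..
  also have "\<dots> = (\<integral>\<^sup>+y. \<integral>\<^sup>+g. \<integral>\<^sup>+w. ?F g w y \<partial>complex_gaussian ?t \<partial>complex_gaussian ?a
      \<partial>PiM (UNIV - {k}) (\<lambda>j. complex_gaussian (?s j)))"
    by (rule nn_integral_channel_observations[where F = ?F, OF _ F]) simp
  also have "\<dots> = ennreal ((if k' = k then (c * ?a / (est_coeff b k * ?s k))\<^sup>2 else 0)
        + ?a * ?t / ?s k * (1 / ((real CARD('m) - real CARD('k)) * ((est_coeff b k')\<^sup>2 * ?s k'))))"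
    by (rule nn_integral_hermitian_zf_column)
      (auto simp: obs_var_pos est_coeff_pos less fading_nonneg s)
  also have "?a * ?t / ?s k = ?a - G"
  proof -
    have "?a * ?t = ?a * ?s k - (c * ?a)\<^sup>2" by (simp add: s power2_eq_square algebra_simps)
    then show ?thesis unfolding G using sp by (simp add: diff_divide_distrib)
  qed
  \<comment> \<open>For \<open>k' = k\<close> the coherent part is \<open>G / gamma S b b k\<close>;
    the factor \<open>CARD('m) - CARD('k)\<close> is inserted to reach the common
    denominator.\<close>
  also have "(if k' = k then (c * ?a / (est_coeff b k * ?s k))\<^sup>2 else 0) =
      (if k' = k then (real CARD('m) - real CARD('k)) * G else 0) / ((real CARD('m) - real CARD('k)) * gamma S b b k')"
    using less sp est_coeff_pos[of b k]
    by (simp add: G gamma_own_eq power_divide power_mult_distrib power2_eq_square mult_ac)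
  finally show ?thesis
    by (simp only: gamma_own_eq[symmetric] add_divide_distrib[symmetric] times_divide_eq_right mult_1_right add.commute)
qed

text \<open>The squared normalisation of the precoder is exactly the denominator left by the mean
  squared inner product, so \<open>gamma S b b k'\<close> cancels.\<close>

lemma integral_channel_gain:
  fixes b l :: 'l and k k' :: 'k
  defines "G \<equiv> if b \<in> group S l then gamma S b l k else 0"
  shows "(\<integral>\<omega>. (cmod (channel_gain S l k b k' \<omega>))\<^sup>2 \<partial>M)
    = max_power S * (fading S b l k - G + (if k' = k then (real CARD('m) - real CARD('k)) * G else 0))"
proof -
  let ?Z = "(real CARD('m) - real CARD('k)) * gamma S b b k'"
  let ?h = "\<lambda>\<omega>. (cmod (hermitian (channel S b l k \<omega>) (zf_direction S b k' \<omega>)))\<^sup>2"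
  let ?c = "fading S b l k - G + (if k' = k then (real CARD('m) - real CARD('k)) * G else 0)"
  have Z: "?Z > 0" using less gamma_own_pos[of b k'] by simp
  have [measurable]: "(\<lambda>\<omega>. zf_direction S b k' \<omega>) \<in> borel_measurable M"
    unfolding zf_direction_eq mmse_estimate_eq by measurable
  \<comment> \<open>These bounds make the result nonnegative, so that the extended nonnegative
    integral can be read as a real one.\<close>
  have G: "0 \<le> G" "G \<le> fading S b l k"
  proof -
    show "0 \<le> G"
      using obs_var_pos[of "group S b" b k] by (simp add: G_def mem_group_iff[of b] gamma_eq)
    have "(pilot_gain l k)\<^sup>2 * fading S b l k \<le> obs_var (group S b) b k" if "l \<in> group S b"
      using sum_nonneg[of "group S b - {l}" "\<lambda>l. (pilot_gain l k)\<^sup>2 * fading S b l k"] that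
        fading_nonneg ul_noise_var_pos
      by (simp add: obs_var_def sum.remove[of _ l])
    then have "fading S b l k * ((pilot_gain l k)\<^sup>2 * fading S b l k) \<le> fading S b l k * obs_var (group S b) b k" if "l \<in> group S b"
      using that by (intro mult_left_mono fading_nonneg)
    then show "G \<le> fading S b l k"
      using obs_var_pos[of "group S b" b k] fading_nonneg[of b l k]
      by (simp add: G_def mem_group_iff[of b] gamma_eq pos_divide_le_eq power2_eq_square mult_ac)
  qed
  have c: "?c \<ge> 0" using G less by simp
  have "(cmod (channel_gain S l k b k' \<omega>))\<^sup>2 = max_power S * ?Z * ?h \<omega>" for \<omega>
  proof -
    have "channel_gain S l k b k' \<omega> = complex_of_real (sqrt (max_power S) * sqrt ?Z)
        * hermitian (channel S b l k \<omega>) (zf_direction S b k' \<omega>)"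
      using Z
      by (simp add: channel_gain_def zf_precoder_def integral_norm_zf_direction hermitian_def
          scaleR_conv_of_real[where 'a = complex] sum_distrib_left real_sqrt_divide mult_ac)
    then show ?thesis
      using max_power_pos Z by (simp add: norm_mult power_mult_distrib del: of_real_mult)
  qed
  then have "(\<integral>\<omega>. (cmod (channel_gain S l k b k' \<omega>))\<^sup>2 \<partial>M) = max_power S * ?Z * (\<integral>\<omega>. ?h \<omega> \<partial>M)"
    by simp
  also have "(\<integral>\<omega>. ?h \<omega> \<partial>M) = ?c / ?Z"
  proof -
    have "(\<integral>\<^sup>+\<omega>. ennreal (?h \<omega>) \<partial>M) = ennreal (?c / ?Z)"
      unfolding G_def mem_group_iff[of b l] by (rule nn_integral_hermitian_zf_direction)
    moreover have "?c / ?Z \<ge> 0" using c Z by (intro divide_nonneg_pos)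
    ultimately show ?thesis
      by (subst integral_eq_nn_integral) (simp_all only: enn2real_ennreal, simp_all)
  qed
  also have "max_power S * ?Z * (?c / ?Z) = max_power S * ?c"
  proof -
    have "r * z * (x / z) = r * x" if "z > 0" for r x z :: real
      using that by simp
    then show ?thesis using Z by blast
  qed
  finally show ?thesis .
qed

text \<open>In the own cell \<open>k' = k\<close> is excluded, so only the error variance is left.
  In another cell of the group the beam for \<open>k' = k\<close> adds the pilot contamination term.
  Outside the group nothing is subtracted from the fading.\<close>

lemma interference_eq:
  "interference S l k =
     (fading S l l k - gamma S l l k)
       * (\<Sum>k'\<in>UNIV - {k}. max_power S * power_coeff S l k')
     + (\<Sum>l'\<in>group S l - {l}. \<Sum>k'\<in>UNIV.
          max_power S * power_coeff S l' k' * (fading S l' l k - gamma S l' l k))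
     + (\<Sum>l'\<in>- group S l. \<Sum>k'\<in>UNIV.
          max_power S * power_coeff S l' k' * fading S l' l k)
     + (real CARD('m) - real CARD('k))
       * (\<Sum>l'\<in>group S l - {l}. max_power S * power_coeff S l' k * gamma S l' l k)
     + dl_noise_var S"
proof -
  let ?I = "\<lambda>l' k'. power_coeff S l' k' * (\<integral>\<omega>. (cmod (channel_gain S l k l' k' \<omega>))\<^sup>2 \<partial>M)"
  have own: "(\<Sum>k'\<in>UNIV - {k}. ?I l k') = (fading S l l k - gamma S l l k)
      * (\<Sum>k'\<in>UNIV - {k}. max_power S * power_coeff S l k')"
    unfolding sum_distrib_left by (intro sum.cong) (auto simp: integral_channel_gain own_group)
  have grp: "(\<Sum>k'\<in>UNIV. ?I l' k') =
      (\<Sum>k'\<in>UNIV. max_power S * power_coeff S l' k' * (fading S l' l k - gamma S l' l k))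
      + (real CARD('m) - real CARD('k)) * (max_power S * power_coeff S l' k * gamma S l' l k)"
    if "l' \<in> group S l - {l}" for l'
  proof -
    have "?I l' k' = max_power S * power_coeff S l' k' * (fading S l' l k - gamma S l' l k)
        + (if k' = k then (real CARD('m) - real CARD('k)) * (max_power S * power_coeff S l' k * gamma S l' l k) else 0)" for k'
      using that by (simp add: integral_channel_gain algebra_simps)
    then show ?thesis by (simp add: sum.distrib)
  qed
  have out: "(\<Sum>k'\<in>UNIV. ?I l' k') = (\<Sum>k'\<in>UNIV. max_power S * power_coeff S l' k' * fading S l' l k)"
    if "l' \<in> - group S l" for l'
    using that by (intro sum.cong) (auto simp: integral_channel_gain)
  have "UNIV - {l} = (group S l - {l}) \<union> - group S l" using own_group by auto
  then have "(\<Sum>l'\<in>UNIV - {l}. \<Sum>k'\<in>UNIV. ?I l' k')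
      = (\<Sum>l'\<in>group S l - {l}. \<Sum>k'\<in>UNIV. ?I l' k') + (\<Sum>l'\<in>- group S l. \<Sum>k'\<in>UNIV. ?I l' k')"
    by (simp only:) (rule sum.union_disjoint, auto)
  then show ?thesis
    unfolding interference_def own by (simp add: grp out sum.distrib sum_distrib_left)
qed

end

end

theorem lemma5:
  fixes S :: "('w, 'l :: finite, 'k :: finite, 'm :: finite) mimo"
    and l :: 'l and k :: 'k and \<tau>\<^sub>c :: nat and \<Theta> :: real and y :: "nat \<Rightarrow> complex"
  assumes "rayleigh_mimo S"
    and "CARD('m) > CARD('k)"
    and "pilot_len S < \<tau>\<^sub>c"
    and "\<Theta> \<ge> interference S l k"
  shows "let T =
           (fading S l l k - gamma S l l k)
             * (\<Sum>k'\<in>UNIV - {k}. max_power S * power_coeff S l k')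
           + (\<Sum>l'\<in>group S l - {l}. \<Sum>k'\<in>UNIV.
                max_power S * power_coeff S l' k' * (fading S l' l k - gamma S l' l k))
           + (\<Sum>l'\<in>- group S l. \<Sum>k'\<in>UNIV.
                max_power S * power_coeff S l' k' * fading S l' l k)
           + (real CARD('m) - real CARD('k))
             * (\<Sum>l'\<in>group S l - {l}. max_power S * power_coeff S l' k * gamma S l' l k)
           + dl_noise_var S
         in interference S l k = T
            \<and> gain_estimate S l k \<tau>\<^sub>c \<Theta> y =
                (if sample_power S \<tau>\<^sub>c y > \<Theta>
                 then complex_of_real (sqrt ((sample_power S \<tau>\<^sub>c y - T) / power_coeff S l k))
                 else (\<integral>\<omega>. channel_gain S l k l k \<omega> \<partial>pspace S))"
  \<comment> \<open>Folding the closed form back into \<open>interference S l k\<close> makes the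
    first conjunct reflexive and the second the definition of the estimator.\<close>
  unfolding Let_def rayleigh_mimo.interference_eq[OF assms(1,2), symmetric]
  by (simp add: gain_estimate_def)

end
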